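(* Let $G$ be a fixed $3$-uniform hypergraph with at least two edges. Then, as $q\to\infty$: (a) If $G \in \mathcal{U}_0$ (i.e. $G$ is tripartite), then $r(G;q) = q^{\Theta(1)}$. (b) If $G \in \mathcal{U}\setminus \mathcal{U}_0$, then $2^{\Omega(q)} \le r(G;q) \le 2^{q^{O(1)}}$. More precisely, if $G \in \mathcal{U}_\ell$, then $r(G;q) \le 2^{O(q^\ell \log q)}$. (c) If $G \notin \mathcal{U}$, then $2^{2^{q/2}} \le r(G;q) \le 2^{2^{O(q\log q)}}$. (Implicit constants depend on $G$.)
   Context: For a $3$-uniform hypergraph ($3$-graph) $G$ and a positive integer $q$, the Ramsey number $r(G;q)$ is the minimum positive integer $N$ such that every coloring of the edges of the complete $3$-graph $K_N^{(3)}$ with $q$ colors contains a monochromatic copy of $G$ (a copy is a subgraph isomorphic to $G$). A $3$-graph is tripartite if its vertex set can be partitioned into three parts such that every edge has exactly one vertex in each part. Collapsing: for a $3$-graph $G$, a set $U\subseteq V(G)$ with $2\le |U|<|V(G)|$ is collapsible if no edge of $G$ intersects $U$ in exactly two vertices. Given such $U$, let $v^*$ be a new vertex and let $H$ be the $3$-graph with vertex set $(V(G)\setminus U)\cup\{v^*\}$ and edge set $\{e\in E(G): e\cap U=\emptyset\}\cup\{xyv^*: \exists u\in U,\ xyu\in E(G)\}$. Then $H$ is obtained from $G$ by collapsing $U$, and $G$ is said to be reducible to the pair $(H, G[U])$, where $G[U]$ is the induced subhypergraph on $U$. The classes $\mathcal{U}_0\subseteq \mathcal{U}_1\subseteq\cdots$: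 $\mathcal{U}_0$ is the set of all tripartite $3$-graphs; $\mathcal{U}_1$ is the set of $3$-graphs $G$ having a vertex subset $S$ such that every edge of $G$ intersects $S$ in exactly one vertex; for $i>1$, $\mathcal{U}_i$ consists of $\mathcal{U}_{i-1}$ together with every $3$-graph $G$ that is reducible to some pair $(H,F)$ with $H\in\mathcal{U}_{i-1}$ and $F\in\mathcal{U}_i$ (this is well defined by induction on the number of vertices, since $v(H),v(F)<v(G)$). Finally $\mathcal{U}=\bigcup_{i\ge 0}\mathcal{U}_i$. *)

theory Defs
  imports Complex_Main "HOL-Library.FuncSet"
begin

type_synonym 'a hgraph = "'a set \<times> 'a set set"

abbreviation verts :: "'a hgraph \<Rightarrow> 'a set" where "verts G \<equiv> fst G"
abbreviation edges :: "'a hgraph \<Rightarrow> 'a set set" where "edges G \<equiv> snd G"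

definition three_graph :: "'a hgraph \<Rightarrow> bool" where
  "three_graph G \<longleftrightarrow> finite (verts G) \<and> (\<forall>e\<in>edges G. e \<subseteq> verts G \<and> card e = 3)"

definition subhypergraph :: "'a hgraph \<Rightarrow> 'a hgraph \<Rightarrow> bool" where
  "subhypergraph H K \<longleftrightarrow> three_graph H \<and> verts H \<subseteq> verts K \<and> edges H \<subseteq> edges K"

definition hgraph_iso :: "'a hgraph \<Rightarrow> 'b hgraph \<Rightarrow> bool" where
  "hgraph_iso G H \<longleftrightarrow> (\<exists>f. bij_betw f (verts G) (verts H) \<and> edges H = (\<lambda>e. f ` e) ` edges G)"

definition complete3 :: "nat \<Rightarrow> nat hgraph" where
  "complete3 N = ({..<N}, {e. e \<subseteq> {..<N} \<and> card e = 3})"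

definition has_mono_copy :: "'a hgraph \<Rightarrow> nat \<Rightarrow> (nat set \<Rightarrow> nat) \<Rightarrow> bool" where
  "has_mono_copy G N c \<longleftrightarrow>
     (\<exists>H k. subhypergraph H (complete3 N) \<and> hgraph_iso G H \<and> (\<forall>e\<in>edges H. c e = k))"

definition ramsey_number :: "'a hgraph \<Rightarrow> nat \<Rightarrow> nat" where
  "ramsey_number G q =
     (LEAST N. N > 0 \<and> (\<forall>c \<in> edges (complete3 N) \<rightarrow> {..<q}. has_mono_copy G N c))"

definition tripartite :: "'a hgraph \<Rightarrow> bool" where
  "tripartite G \<longleftrightarrow> (\<exists>A B C. A \<union> B \<union> C = verts G \<and> A \<inter> B = {} \<and> A \<inter> C = {} \<and> B \<inter> C = {} \<and>
     (\<forall>e\<in>edges G. card (e \<inter> A) = 1 \<and> card (e \<inter> B) = 1 \<and> card (e \<inter> C) = 1))"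

definition induced :: "'a hgraph \<Rightarrow> 'a set \<Rightarrow> 'a hgraph" where
  "induced G U = (U, {e \<in> edges G. e \<subseteq> U})"

definition collapsible :: "'a hgraph \<Rightarrow> 'a set \<Rightarrow> bool" where
  "collapsible G U \<longleftrightarrow> U \<subseteq> verts G \<and> 2 \<le> card U \<and> card U < card (verts G) \<and>
     (\<forall>e\<in>edges G. card (e \<inter> U) \<noteq> 2)"

definition collapse :: "'a hgraph \<Rightarrow> 'a set \<Rightarrow> 'a \<Rightarrow> 'a hgraph" where
  "collapse G U v =
     (insert v (verts G - U),
      {e \<in> edges G. e \<inter> U = {}} \<union>
      {{x, y, v} | x y. x \<in> verts G - U \<and> y \<in> verts G - U \<and> (\<exists>u\<in>U. {x, y, u} \<in> edges G)})"

text \<open>The new vertex only has to differ from the vertices that survive the collapse. It may be an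
  element of \<open>U\<close>, so that it exists even if the vertices of \<open>G\<close> exhaust the type.\<close>

definition reducible_to :: "'a hgraph \<Rightarrow> 'a hgraph \<Rightarrow> 'a hgraph \<Rightarrow> bool" where
  "reducible_to G H F \<longleftrightarrow>
     (\<exists>U v. collapsible G U \<and> v \<notin> verts G - U \<and> H = collapse G U v \<and> F = induced G U)"

text \<open>The class \<open>\<U>\<^sub>i\<close> for \<open>i > 1\<close> as a function of \<open>W = \<U>\<^bsub>i-1\<^esub>\<close>. The least fixed point agrees with
  the recursion on the number of vertices because \<open>F\<close> has fewer vertices than \<open>G\<close>.\<close>

inductive_set next_class :: "'a hgraph set \<Rightarrow> 'a hgraph set" for W :: "'a hgraph set" where
  base: "G \<in> W \<Longrightarrow> G \<in> next_class W"
| reduce: "three_graph G \<Longrightarrow> reducible_to G H F \<Longrightarrow> H \<in> W \<Longrightarrow> F \<in> next_class W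
    \<Longrightarrow> G \<in> next_class W"

fun U_class :: "nat \<Rightarrow> 'a hgraph set" where
  "U_class 0 = {G. three_graph G \<and> tripartite G}"
| "U_class (Suc 0) =
     {G. three_graph G \<and> (\<exists>S \<subseteq> verts G. \<forall>e\<in>edges G. card (e \<inter> S) = 1)}"
| "U_class (Suc (Suc i)) = next_class (U_class (Suc i))"

definition U_all :: "'a hgraph set" where
  "U_all = (\<Union>i. U_class i)"

end

theory Submission
  imports Defs
begin

text \<open>
  Upper bounds. A complete tripartite hypergraph is found by applying the pigeonhole principle to each
  of the three parts in turn. For \<open>\<U>\<^sub>1\<close>, every vertex \<open>s\<close> induces a colouring of the pairs of a set \<open>T\<close> of
  size \<open>q\<^bsup>O(q)\<^esup>\<close>, which contains a large monochromatic clique; by pigeonhole many vertices \<open>s\<close> share the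
  clique and its colour. For \<open>\<U>\<^bsub>l+1\<^esub>\<close>, assign to every colour \<open>k\<close> a hypergraph that has to appear in it.
  If this hypergraph is reducible to \<open>(H, F)\<close>, averaging over the transversals of \<open>r(H;q)\<close> equal blocks yields, for some
  \<open>k\<close>, a copy of \<open>H\<close> of colour \<open>k\<close> whose collapsed vertex is blown up to a set \<open>W\<close> that contains a fraction
  \<open>1 / r(H;q)\<^bsup>O(1)\<^esup>\<close> of the vertices. Inside \<open>W\<close> it then suffices to find \<open>F\<close> in colour \<open>k\<close>. There are at
  most \<open>O(q)\<close> such steps. The bound for arbitrary hypergraphs is that of Erdos and Rado.

  Lower bounds. With \<open>N\<^sup>3 \<le> q\<close> all edges can get different colours. If \<open>G\<close> is not tripartite, greedily
  chosen tripartitions, each of which covers a constant fraction of the triples not yet covered, give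
  the colour classes. If \<open>G \<notin> \<U>\<close>, squaring the number of vertices costs two colours: the
  lexicographic product of a colouring with itself is coloured such that a monochromatic hypergraph
  can be reduced to monochromatic hypergraphs of the factors.
\<close>

section \<open>Monochromatic embeddings and the Ramsey number\<close>

definition coloring :: "nat set \<Rightarrow> nat \<Rightarrow> (nat set \<Rightarrow> nat) \<Rightarrow> bool" where
  "coloring X q c \<longleftrightarrow> (\<forall>e\<subseteq>X. card e = 3 \<longrightarrow> c e < q)"

text \<open>Copies are encoded by injections rather than by subhypergraphs, because injections can
  be composed, moved to larger host sets and glued along collapsed vertices. The host is an
  arbitrary set of numbers, so that passing to a subset needs no relabelling.\<close>

definition mono_embeds :: "'a hgraph \<Rightarrow> nat set \<Rightarrow> (nat set \<Rightarrow> nat) \<Rightarrow> nat \<Rightarrow> bool" where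
  "mono_embeds G X c k \<longleftrightarrow>
     (\<exists>f. inj_on f (verts G) \<and> f ` verts G \<subseteq> X \<and> (\<forall>e\<in>edges G. c (f ` e) = k))"

text \<open>The asymmetric Ramsey property: \<open>g k\<close> is the hypergraph that is sought in colour \<open>k\<close>.\<close>

definition forces :: "(nat \<Rightarrow> 'a hgraph) \<Rightarrow> nat \<Rightarrow> nat \<Rightarrow> bool" where
  "forces g q N \<longleftrightarrow> (\<forall>X c. finite X \<longrightarrow> N \<le> card X \<longrightarrow> coloring X q c \<longrightarrow>
     (\<exists>k<q. mono_embeds (g k) X c k))"

lemma coloring_mono: "coloring X q c \<Longrightarrow> Y \<subseteq> X \<Longrightarrow> coloring Y q c"
  unfolding coloring_def by blast

lemma mono_embeds_mono: "mono_embeds G Y c k \<Longrightarrow> Y \<subseteq> X \<Longrightarrow> mono_embeds G X c k"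
  unfolding mono_embeds_def by blast

lemma forcesD:
  "forces g q N \<Longrightarrow> finite X \<Longrightarrow> N \<le> card X \<Longrightarrow> coloring X q c \<Longrightarrow> \<exists>k<q. mono_embeds (g k) X c k"
  unfolding forces_def by blast

lemma forces_mono: "forces g q M \<Longrightarrow> M \<le> N \<Longrightarrow> forces g q N"
  unfolding forces_def by (meson le_trans)

lemma three_graph_finite_edge:
  assumes "three_graph G" "e \<in> edges G"
  shows "finite e" "e \<subseteq> verts G" "card e = 3"
  using assms unfolding three_graph_def by (auto intro: card_ge_0_finite)

text \<open>An isomorphism onto a subhypergraph is in particular an injection. Conversely the image
  of \<open>G\<close> under an injection is a 3-graph, since injectivity keeps the size of the
  edges.\<close>

lemma has_mono_copy_iff:
  assumes "three_graph G"
  shows "has_mono_copy G N c \<longleftrightarrow> (\<exists>k. mono_embeds G {..<N} c k)"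
proof
  assume "has_mono_copy G N c"
  then obtain H k where H: "subhypergraph H (complete3 N)" "hgraph_iso G H" "\<forall>e\<in>edges H. c e = k"
    unfolding has_mono_copy_def by (elim exE conjE)
  from H(2) obtain f where "bij_betw f (verts G) (verts H)" "edges H = (\<lambda>e. f ` e) ` edges G"
    unfolding hgraph_iso_def by (elim exE conjE)
  with H(1,3) have "inj_on f (verts G)" "f ` verts G \<subseteq> {..<N}" "\<forall>e\<in>edges G. c (f ` e) = k"
    unfolding subhypergraph_def complete3_def by (simp_all add: bij_betw_def)
  then have "mono_embeds G {..<N} c k"
    unfolding mono_embeds_def by blast
  then show "\<exists>k. mono_embeds G {..<N} c k" ..
next
  assume "\<exists>k. mono_embeds G {..<N} c k"
  then obtain k f where f: "inj_on f (verts G)" "f ` verts G \<subseteq> {..<N}" "\<forall>e\<in>edges G. c (f ` e) = k"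
    unfolding mono_embeds_def by blast
  let ?H = "(f ` verts G, (\<lambda>e. f ` e) ` edges G)"
  have *: "f ` e \<subseteq> f ` verts G" "card (f ` e) = 3" if "e \<in> edges G" for e
    using three_graph_finite_edge[OF assms that] card_image[of f e] inj_on_subset[OF f(1)]
    by (simp_all add: image_mono)
  have "three_graph ?H"
    using assms * unfolding three_graph_def by auto
  moreover have "(\<lambda>e. f ` e) ` edges G \<subseteq> {e. e \<subseteq> {..<N} \<and> card e = 3}"
    using * f(2) by blast
  ultimately have "subhypergraph ?H (complete3 N)"
    using f(2) unfolding subhypergraph_def complete3_def by simp
  moreover have "hgraph_iso G ?H"
    unfolding hgraph_iso_def using f(1) by (intro exI[of _ f]) (simp add: bij_betw_def)
  ultimately show "has_mono_copy G N c"
    unfolding has_mono_copy_def using f(3) by (intro exI[of _ ?H] exI[of _ k]) simp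
qed

lemma coloring_iff: "coloring {..<N} q c \<longleftrightarrow> c \<in> edges (complete3 N) \<rightarrow> {..<q}"
  unfolding coloring_def complete3_def by auto

lemma forces_ramsey:
  assumes "three_graph G" "forces (\<lambda>_. G) q N" "c \<in> edges (complete3 N) \<rightarrow> {..<q}"
  shows "has_mono_copy G N c"
proof -
  have "\<exists>k<q. mono_embeds G {..<N} c k"
    using assms(2,3) unfolding forces_def coloring_iff[symmetric] by simp
  then show ?thesis
    using has_mono_copy_iff[OF assms(1)] by blast
qed

lemma ramsey_number_le:
  assumes "three_graph G" "forces (\<lambda>_. G) q N" "N > 0"
  shows "ramsey_number G q \<le> N"
  unfolding ramsey_number_def
  by (rule Least_le) (use assms forces_ramsey in blast)

text \<open>The bound \<open>M\<close> ensures that the \<open>LEAST\<close> in the definition is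
  attained, so \<open>ramsey_number G q\<close> itself has the Ramsey property. If it were at most
  \<open>N\<close>, restricting \<open>c\<close> would yield a monochromatic copy.\<close>

lemma less_ramsey_number:
  assumes G: "three_graph G" and "forces (\<lambda>_. G) q M"
    and c: "coloring {..<N} q c" "\<And>k. \<not> mono_embeds G {..<N} c k"
  shows "N < ramsey_number G q"
proof (rule ccontr)
  let ?r = "ramsey_number G q"
  assume le: "\<not> N < ?r"
  \<comment> \<open>The minimum is taken over positive integers, and \<open>M\<close> may be
    0.\<close>
  have "forces (\<lambda>_. G) q (Suc M)"
    using assms(2) by (rule forces_mono) simp
  then have "\<exists>N. N > 0 \<and> (\<forall>c \<in> edges (complete3 N) \<rightarrow> {..<q}. has_mono_copy G N c)"
    using forces_ramsey[OF G] by blast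
  then have "\<forall>c \<in> edges (complete3 ?r) \<rightarrow> {..<q}. has_mono_copy G ?r c"
    unfolding ramsey_number_def by (rule LeastI2_ex) blast
  moreover have "coloring {..<?r} q c"
    using c(1) le by (intro coloring_mono[OF c(1)]) auto
  ultimately obtain k where "mono_embeds G {..<?r} c k"
    using has_mono_copy_iff[OF G] coloring_iff by blast
  then have "mono_embeds G {..<N} c k"
    by (rule mono_embeds_mono) (use le in auto)
  with c(2) show False by blast
qed

lemma pigeonhole_fibre:
  assumes "finite A" "finite B" "B \<noteq> {}" "f \<in> A \<rightarrow> B" "card B * w \<le> card A"
  shows "\<exists>b\<in>B. w \<le> card {a\<in>A. f a = b}"
proof -
  obtain b where b: "b \<in> B" "card (f -` {b} \<inter> A) * card B \<ge> card A"
    using pigeonhole_card[OF assms(4,1,2,3)] by blast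
  have "f -` {b} \<inter> A = {a\<in>A. f a = b}" by auto
  moreover have "card B * w \<le> card B * card (f -` {b} \<inter> A)"
    using assms(5) b(2) by (metis le_trans mult.commute)
  ultimately show ?thesis
    using b(1) assms(2,3) by (metis card_gt_0_iff mult_le_cancel1)
qed

section \<open>Complete hypergraphs\<close>

text \<open>Induction on the sum of the clique sizes. Some colour \<open>k\<close> joins a vertex
  \<open>x\<close> to at least \<open>(q + 1) ^ p\<close> others; among these \<open>n k\<close> is
  lowered by one, and a clique found there in colour \<open>k\<close> is extended by
  \<open>x\<close>. The base is \<open>q + 1\<close> rather than \<open>q\<close> to pay for the
  removal of \<open>x\<close>.\<close>

lemma ramsey_pairs:
  fixes n :: "nat \<Rightarrow> nat"
  assumes "finite X" "q > 0" "\<And>x y. x \<in> X \<Longrightarrow> y \<in> X \<Longrightarrow> x \<noteq> y \<Longrightarrow> \<chi> {x, y} < q"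
    and "(q + 1) ^ (\<Sum>k<q. n k) \<le> card X"
  shows "\<exists>k<q. \<exists>T\<subseteq>X. card T = n k \<and> (\<forall>x\<in>T. \<forall>y\<in>T. x \<noteq> y \<longrightarrow> \<chi> {x, y} = k)"
  using assms
proof (induction "\<Sum>k<q. n k" arbitrary: n X)
  case 0
  then have "n 0 = 0" by simp
  then show ?case
    using \<open>q > 0\<close> by (intro exI[of _ 0] conjI exI[of _ "{}"]) auto
next
  case (Suc p)
  show ?case
  proof (cases "\<exists>k<q. n k = 0")
    case True
    then obtain k where "k < q" "n k = 0" by blast
    then show ?thesis
      by (intro exI[of _ k] conjI exI[of _ "{}"]) auto
  next
    case False
    have pw: "1 \<le> (q + 1) ^ p" by simp
    have card: "(q + 1) ^ p * (q + 1) \<le> card X"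
      using Suc.prems(4) Suc.hyps(2) by (metis power_Suc2)
    then have "X \<noteq> {}" by auto
    then obtain x where x: "x \<in> X" by blast
    have "card {..<q} * (q + 1) ^ p \<le> card (X - {x})"
    proof -
      have "q * (q + 1) ^ p + (q + 1) ^ p \<le> card X"
        using card by (simp add: algebra_simps)
      with pw have "q * (q + 1) ^ p \<le> card X - 1" by linarith
      then show ?thesis using x Suc.prems(1) by simp
    qed
    moreover have "(\<lambda>y. \<chi> {x, y}) \<in> X - {x} \<rightarrow> {..<q}"
      using Suc.prems(3) x by auto
    ultimately obtain k where k: "k < q" "(q + 1) ^ p \<le> card {y \<in> X - {x}. \<chi> {x, y} = k}"
      using pigeonhole_fibre[of "X - {x}" "{..<q}" "\<lambda>y. \<chi> {x, y}"] Suc.prems(1,2) by force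
    let ?Y = "{y \<in> X - {x}. \<chi> {x, y} = k}" and ?n = "n(k := n k - 1)"
    have nk: "n k > 0" using False k(1) by auto
    have "(\<Sum>j<q. n j) = n k + (\<Sum>j\<in>{..<q} - {k}. n j)"
      using k(1) by (simp add: sum.remove)
    moreover have "(\<Sum>j<q. ?n j) = ?n k + (\<Sum>j\<in>{..<q} - {k}. ?n j)"
      using k(1) by (intro sum.remove) auto
    moreover have "(\<Sum>j\<in>{..<q} - {k}. ?n j) = (\<Sum>j\<in>{..<q} - {k}. n j)"
      by (rule sum.cong) auto
    ultimately have p: "p = (\<Sum>j<q. ?n j)"
      using nk Suc.hyps(2) by simp
    have "\<exists>j<q. \<exists>T\<subseteq>?Y. card T = ?n j \<and> (\<forall>x\<in>T. \<forall>y\<in>T. x \<noteq> y \<longrightarrow> \<chi> {x, y} = j)"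
      using Suc.prems k(2) p by (intro Suc.hyps(1)[OF p]) auto
    then obtain j T where T: "j < q" "T \<subseteq> ?Y" "card T = ?n j"
      "\<forall>x\<in>T. \<forall>y\<in>T. x \<noteq> y \<longrightarrow> \<chi> {x, y} = j" by blast
    show ?thesis
    proof (cases "j = k")
      case True
      have "finite T" "x \<notin> T"
        using T(2) Suc.prems(1) finite_subset[of T X] by auto
      then have "card (insert x T) = n k"
        using T(3) True nk by simp
      moreover have "\<forall>y\<in>insert x T. \<forall>z\<in>insert x T. y \<noteq> z \<longrightarrow> \<chi> {y, z} = k"
        using T(2,4) True by (auto simp: insert_commute)
      ultimately show ?thesis
        using T(2) x k(1) by (intro exI[of _ k] conjI exI[of _ "insert x T"]) auto
    next
      case False
      then show ?thesis
        using T by (intro exI[of _ j] conjI exI[of _ T]) auto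
    qed
  qed
qed

text \<open>A list is end-homogeneous if the colour of a triple does not depend on its last element; the
  set \<open>A\<close> collects the elements to the left of the list.\<close>

fun end_homogeneous :: "(nat set \<Rightarrow> nat) \<Rightarrow> nat set \<Rightarrow> nat list \<Rightarrow> bool" where
  "end_homogeneous c A [] \<longleftrightarrow> True"
| "end_homogeneous c A (y # ys) \<longleftrightarrow>
     (\<forall>x\<in>A. \<forall>z\<in>set ys. \<forall>z'\<in>set ys. c {x, y, z} = c {x, y, z'}) \<and>
     end_homogeneous c (insert y A) ys"

text \<open>Passing to the tail of the list moves its head into the set on the left, so an
  \<open>x\<close> that precedes position \<open>j\<close> in the list ends up in that set by the
  time \<open>j\<close> is the head.\<close>

lemma end_homogeneous_nth:
  assumes "end_homogeneous c A ys" "j < k" "k < length ys" "j < l" "l < length ys"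
    "x \<in> A \<or> (\<exists>i<j. x = ys ! i)"
  shows "c {x, ys ! j, ys ! k} = c {x, ys ! j, ys ! l}"
  using assms
proof (induction ys arbitrary: A j k l)
  case (Cons y ys)
  have hom: "\<forall>x\<in>A. \<forall>z\<in>set ys. \<forall>z'\<in>set ys. c {x, y, z} = c {x, y, z'}"
    and tail: "end_homogeneous c (insert y A) ys"
    using Cons.prems(1) unfolding end_homogeneous.simps by blast+
  obtain k' l' where kl: "k = Suc k'" "l = Suc l'"
    using Cons.prems(2,4) by (cases k; cases l) simp_all
  show ?case
  proof (cases j)
    case 0
    then have "x \<in> A" using Cons.prems(6) by simp
    moreover have "ys ! k' \<in> set ys" "ys ! l' \<in> set ys"
      using Cons.prems(3,5) kl by simp_all
    ultimately have "c {x, y, ys ! k'} = c {x, y, ys ! l'}" using hom by blast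
    then show ?thesis using 0 kl by simp
  next
    case (Suc j')
    have "x \<in> insert y A \<or> (\<exists>i<j'. x = ys ! i)"
      using Cons.prems(6) unfolding Suc less_Suc_eq_0_disj by auto
    then have "c {x, ys ! j', ys ! k'} = c {x, ys ! j', ys ! l'}"
      using Cons.prems(2-5) Suc kl by (intro Cons.IH[OF tail]) simp_all
    then show ?thesis using Suc kl by simp
  qed
qed simp

text \<open>Take any \<open>y\<close> in \<open>Y\<close> as the next element, classify every other
  \<open>z\<close> by the map sending \<open>x\<close> in \<open>A\<close> to the colour of
  \<open>{x, y, z}\<close>, and continue in the largest of the at most \<open>q ^ card A\<close>
  classes. The quantity \<open>card A + r\<close> is the same in all rounds, so each of the
  \<open>r\<close> rounds costs at most a factor \<open>(q + 1) ^ (card A + r)\<close>.\<close>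

lemma end_homogeneous_exists:
  assumes "finite A" "finite Y" "A \<inter> Y = {}" "q > 0" "coloring (A \<union> Y) q c"
    "(q + 1) ^ ((card A + r) * r) \<le> card Y"
  shows "\<exists>ys. length ys = r \<and> distinct ys \<and> set ys \<subseteq> Y \<and> end_homogeneous c A ys"
  using assms
proof (induction r arbitrary: A Y)
  case (Suc r)
  let ?a = "card A" and ?w = "(q + 1) ^ ((card A + Suc r) * r)"
  have "(card A + Suc r) * Suc r = (card A + Suc r) * r + (card A + Suc r)" by simp
  then have *: "?w * (q + 1) ^ (?a + Suc r) \<le> card Y"
    using Suc.prems(6) by (metis power_add)
  \<comment> \<open>The summand 1 leaves room for removing \<open>y\<close>.\<close>
  have "q ^ ?a + 1 \<le> (q + 1) ^ (?a + 1)"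
  proof -
    have "q ^ ?a \<le> (q + 1) ^ ?a" by (rule power_mono) auto
    moreover have "1 \<le> q * (q + 1) ^ ?a" using Suc.prems(4) by simp
    moreover have "(q + 1) ^ (?a + 1) = q * (q + 1) ^ ?a + (q + 1) ^ ?a" by simp
    ultimately show ?thesis by linarith
  qed
  also have "\<dots> \<le> (q + 1) ^ (?a + Suc r)" by (rule power_increasing) auto
  finally have "?w * (q ^ ?a + 1) \<le> card Y"
    using * by (meson le_trans mult_le_mono2)
  moreover have "1 \<le> ?w" by simp
  moreover have "?w * (q ^ ?a + 1) = q ^ ?a * ?w + ?w" by (simp only: algebra_simps mult_1)
  ultimately have big: "q ^ ?a * ?w + 1 \<le> card Y" by linarith
  then have "Y \<noteq> {}" by auto
  then obtain y where y: "y \<in> Y" by blast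
  let ?f = "\<lambda>z. \<lambda>x\<in>A. c {x, y, z}"
  have col: "c {x, y, z} < q" if "x \<in> A" "z \<in> Y - {y}" for x z
  proof -
    have "x \<noteq> y" "x \<noteq> z" "y \<noteq> z" using that y Suc.prems(3) by auto
    then have "card {x, y, z} = 3" by simp
    moreover have "{x, y, z} \<subseteq> A \<union> Y" using that y by auto
    ultimately show ?thesis using Suc.prems(5) unfolding coloring_def by simp
  qed
  have "card (A \<rightarrow>\<^sub>E {..<q}) * ?w \<le> card (Y - {y})"
  proof -
    have "card (A \<rightarrow>\<^sub>E {..<q}) = q ^ ?a" using Suc.prems(1) by (simp add: card_funcsetE)
    moreover have "card (Y - {y}) = card Y - 1" using y Suc.prems(2) by simp
    ultimately show ?thesis using big by simp
  qed
  moreover have "?f \<in> Y - {y} \<rightarrow> (A \<rightarrow>\<^sub>E {..<q})"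
    using col by (intro funcsetI) (auto simp: restrict_PiE_iff)
  moreover have "(A \<rightarrow>\<^sub>E {..<q}) \<noteq> {}"
    using Suc.prems(4) by (auto simp: PiE_eq_empty_iff)
  moreover have "finite (Y - {y})" "finite (A \<rightarrow>\<^sub>E {..<q})"
    using Suc.prems(1,2) by (auto intro: finite_PiE)
  ultimately obtain h where h: "?w \<le> card {z \<in> Y - {y}. ?f z = h}"
    using pigeonhole_fibre[of "Y - {y}" "A \<rightarrow>\<^sub>E {..<q}" ?f ?w] by blast
  let ?Z = "{z \<in> Y - {y}. ?f z = h}"
  have yA: "y \<notin> A" using y Suc.prems(3) by auto
  have "\<exists>ys. length ys = r \<and> distinct ys \<and> set ys \<subseteq> ?Z \<and> end_homogeneous c (insert y A) ys"
  proof (rule Suc.IH)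
    show "coloring (insert y A \<union> ?Z) q c"
      by (rule coloring_mono[OF Suc.prems(5)]) (use y in auto)
    have "card (insert y A) + r = card A + Suc r"
      using yA Suc.prems(1) by simp
    with h show "(q + 1) ^ ((card (insert y A) + r) * r) \<le> card ?Z" by (simp only:)
  qed (use Suc.prems in auto)
  then obtain ys where ys: "length ys = r" "distinct ys" "set ys \<subseteq> ?Z"
    "end_homogeneous c (insert y A) ys" by blast
  have "c {x, y, z} = c {x, y, z'}" if "x \<in> A" "z \<in> set ys" "z' \<in> set ys" for x z z'
  proof -
    have "?f z = ?f z'" using that ys(3) by auto
    then show ?thesis using that(1) by (metis (mono_tags, lifting) restrict_apply')
  qed
  then have "end_homogeneous c A (y # ys)"
    using ys(4) unfolding end_homogeneous.simps by blast
  moreover have "length (y # ys) = Suc r" "distinct (y # ys)" "set (y # ys) \<subseteq> Y"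
    using ys(1-3) y by auto
  ultimately show ?case by blast
qed simp

text \<open>Along an end-homogeneous list the colour of a triple is determined by its first two
  elements, so Ramsey's theorem for pairs yields \<open>n\<close> elements all of whose triples have
  the same colour. Any hypergraph on at most \<open>n\<close> vertices embeds there.\<close>

lemma forces_general:
  assumes G: "\<And>k. k < q \<Longrightarrow> three_graph (g k)" "\<And>k. k < q \<Longrightarrow> card (verts (g k)) \<le> n" and "q > 0"
  shows "forces g q ((q + 1) ^ (((q + 1) ^ (q * n) + 1)\<^sup>2))"
  unfolding forces_def
proof (intro allI impI)
  fix X c
  assume X: "finite X" "(q + 1) ^ (((q + 1) ^ (q * n) + 1)\<^sup>2) \<le> card X" "coloring X q c"
  define R where "R = (q + 1) ^ (q * n)"
  have "\<exists>ys. length ys = R + 1 \<and> distinct ys \<and> set ys \<subseteq> X \<and> end_homogeneous c {} ys"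
  proof (rule end_homogeneous_exists)
    show "(q + 1) ^ ((card {} + (R + 1)) * (R + 1)) \<le> card X"
      using X(2) unfolding R_def[symmetric] power2_eq_square by (simp only: card.empty add_0)
  qed (use X \<open>q > 0\<close> in auto)
  then obtain ys where ys: "length ys = R + 1" "distinct ys" "set ys \<subseteq> X" "end_homogeneous c {} ys"
    by blast
  \<comment> \<open>The last entry \<open>ys ! R\<close> serves as the third vertex of every pair of
    earlier positions; \<open>Min\<close> and \<open>Max\<close> merely name the two elements of the
    pair.\<close>
  define \<chi> where "\<chi> e = c {ys ! Min e, ys ! Max e, ys ! R}" for e
  have lt: "\<chi> {i, j} < q" if "i < j" "j < R" for i j
  proof -
    have "ys ! i \<noteq> ys ! j" "ys ! i \<noteq> ys ! R" "ys ! j \<noteq> ys ! R"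
      using that ys(1,2) by (simp_all add: nth_eq_iff_index_eq)
    then have "card {ys ! i, ys ! j, ys ! R} = 3" by simp
    moreover have "{ys ! i, ys ! j, ys ! R} \<subseteq> X"
      using that ys(1) by (intro subset_trans[OF _ ys(3)]) simp
    ultimately show ?thesis
      using X(3) that unfolding \<chi>_def coloring_def by simp
  qed
  have "\<chi> {i, j} < q" if "i \<in> {..<R}" "j \<in> {..<R}" "i \<noteq> j" for i j
    using that lt[of i j] lt[of j i] by (cases "i < j") (auto simp: insert_commute)
  moreover have "(q + 1) ^ (\<Sum>k<q. n) \<le> card {..<R}" unfolding R_def by simp
  ultimately have "\<exists>k<q. \<exists>T\<subseteq>{..<R}. card T = n \<and> (\<forall>x\<in>T. \<forall>y\<in>T. x \<noteq> y \<longrightarrow> \<chi> {x, y} = k)"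
    using \<open>q > 0\<close> by (intro ramsey_pairs[where n = "\<lambda>_. n"]) simp_all
  then obtain k T where k: "k < q" and T: "T \<subseteq> {..<R}" "card T = n"
    "\<And>x y. x \<in> T \<Longrightarrow> y \<in> T \<Longrightarrow> x \<noteq> y \<Longrightarrow> \<chi> {x, y} = k"
    by blast
  have finT: "finite T" using T(1) finite_subset by blast
  have sorted: "c {ys ! i, ys ! j, ys ! l} = k" if "i \<in> T" "j \<in> T" "l \<in> T" "i < j" "j < l" for i j l
  proof -
    have "c {ys ! i, ys ! j, ys ! l} = c {ys ! i, ys ! j, ys ! R}"
      using that T(1) ys(1) by (intro end_homogeneous_nth[OF ys(4)]) auto
    also have "\<dots> = \<chi> {i, j}" unfolding \<chi>_def using that by simp
    finally show ?thesis using T(3)[of i j] that by simp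
  qed
  have triple: "c ((!) ys ` e) = k" if e: "e \<subseteq> T" "card e = 3" for e
  proof -
    have "finite e" using e(2) by (auto intro: card_ge_0_finite)
    obtain i j l where ijl: "sorted_list_of_set e = [i, j, l]"
    proof -
      have "length (sorted_list_of_set e) = Suc (Suc (Suc 0))" using e(2) by simp
      then show thesis using that by (simp only: length_Suc_conv length_0_conv) blast
    qed
    then have "e = {i, j, l}" "i < j" "j < l"
      using \<open>finite e\<close> set_sorted_list_of_set[of e] strict_sorted_list_of_set[of e] by auto
    then show ?thesis using sorted[of i j l] e(1) by simp
  qed
  obtain f where f: "f ` verts (g k) \<subseteq> T" "inj_on f (verts (g k))"
    using card_le_inj[of "verts (g k)" T] G k T(2) finT unfolding three_graph_def by auto
  have "inj_on ((!) ys) T"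
    by (rule inj_on_nth[OF ys(2)]) (use T(1) ys(1) in auto)
  then have "inj_on ((!) ys \<circ> f) (verts (g k))"
    using f by (meson comp_inj_on inj_on_subset)
  moreover have "((!) ys \<circ> f) ` verts (g k) \<subseteq> X"
  proof -
    have "(!) ys ` T \<subseteq> set ys"
      using T(1) ys(1) by (auto intro!: nth_mem)
    then show ?thesis using f(1) ys(3) unfolding image_comp[symmetric] by blast
  qed
  moreover have "c (((!) ys \<circ> f) ` e) = k" if "e \<in> edges (g k)" for e
  proof -
    have "e \<subseteq> verts (g k)" "card e = 3" using three_graph_finite_edge[OF G(1)[OF k] that] by auto
    then have "f ` e \<subseteq> T" "card (f ` e) = 3"
      using f by (auto simp: card_image inj_on_subset)
    then show ?thesis using triple[of "f ` e"] by (simp add: image_comp)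
  qed
  ultimately show "\<exists>k<q. mono_embeds (g k) X c k"
    using k unfolding mono_embeds_def by blast
qed

text \<open>The labels are arbitrary, so they may record embeddings found in earlier rounds of the
  pigeonhole principle. The embeddings are extensional so that there are only finitely many of
  them.\<close>

lemma constant_embedding:
  fixes \<chi> :: "nat \<Rightarrow> 'c"
  assumes "finite V" "finite X" "finite L" "L \<noteq> {}" "\<chi> \<in> X \<rightarrow> L" "card L * card V \<le> card X"
  shows "\<exists>l\<in>L. \<exists>f\<in>V \<rightarrow>\<^sub>E X. inj_on f V \<and> (\<forall>v\<in>V. \<chi> (f v) = l)"
proof -
  obtain l where l: "l \<in> L" "card V \<le> card {x\<in>X. \<chi> x = l}"
    using pigeonhole_fibre[OF assms(2,3,4,5,6)] by blast
  moreover have "finite {x\<in>X. \<chi> x = l}" using assms(2) by simp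
  ultimately obtain f where f: "f ` V \<subseteq> {x\<in>X. \<chi> x = l}" "inj_on f V"
    using card_le_inj[OF assms(1)] by blast
  have "restrict f V \<in> V \<rightarrow>\<^sub>E X" using f(1) by auto
  moreover have "inj_on (restrict f V) V" using f(2) by simp
  moreover have "\<forall>v\<in>V. \<chi> (restrict f V v) = l" using f(1) by auto
  ultimately show ?thesis using l(1) by blast
qed

lemma split_card:
  assumes "finite X" "a + b \<le> card X"
  obtains A B where "A \<subseteq> X" "B \<subseteq> X" "A \<inter> B = {}" "card A = a" "b \<le> card B"
proof -
  obtain A where A: "A \<subseteq> X" "card A = a"
    using obtain_subset_with_card_n[of a X] assms(2) by auto
  have "card (X - A) = card X - a"
    using A assms(1) by (metis card_Diff_subset finite_subset)
  then show thesis
    using that[of A "X - A"] A assms(2) by auto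
qed

lemma card_Int_1E:
  assumes "card (e \<inter> S) = 1"
  obtains s where "e \<inter> S = {s}" "s \<in> e" "s \<in> S"
  using assms by (auto simp: card_1_singleton_iff)

section \<open>Tripartite hypergraphs\<close>

lemma le_power_self: "(n::nat) \<le> q ^ n" if "q \<ge> 2"
proof -
  have "n \<le> 2 ^ n" by (simp add: less_imp_le)
  also have "\<dots> \<le> q ^ n" using that by (rule power_mono) simp
  finally show ?thesis .
qed

lemma color_triple:
  assumes "coloring X q c" "x \<in> X" "y \<in> X" "z \<in> X" "x \<noteq> y" "x \<noteq> z" "y \<noteq> z"
  shows "c {x, y, z} < q"
proof -
  have "card {x, y, z} = 3" "{x, y, z} \<subseteq> X" using assms(2-) by simp_all
  then show ?thesis using assms(1) unfolding coloring_def by simp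
qed

text \<open>Three nested pigeonholes. For fixed \<open>y\<close> and \<open>z\<close>,
  \<open>n\<close> vertices of \<open>XA\<close> agree in colour; \<open>D1 y z\<close> records the
  colour and their embedding, one of \<open>q * card XA ^ n\<close> labels. For fixed
  \<open>z\<close>, \<open>n\<close> vertices \<open>y\<close> agree in \<open>D1\<close>, and
  \<open>D2 z\<close> records that label with their embedding. Finally \<open>n\<close> vertices
  \<open>z\<close> agree in \<open>D2\<close>.\<close>

lemma color_tripartite:
  assumes X: "coloring X q c" "finite X" "XA \<subseteq> X" "XB \<subseteq> X" "XC \<subseteq> X"
      "XA \<inter> XB = {}" "XA \<inter> XC = {}" "XB \<inter> XC = {}"
    and "q > 0" "n > 0" "q * n \<le> card XA"
      "q * card XA ^ n * n \<le> card XB" "q * card XA ^ n * card XB ^ n * n \<le> card XC"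
  shows "\<exists>k<q. \<exists>f h j. f \<in> {..<n} \<rightarrow>\<^sub>E XA \<and> inj_on f {..<n} \<and> h \<in> {..<n} \<rightarrow>\<^sub>E XB \<and> inj_on h {..<n} \<and>
    j \<in> {..<n} \<rightarrow>\<^sub>E XC \<and> inj_on j {..<n} \<and> (\<forall>a<n. \<forall>b<n. \<forall>d<n. c {f a, h b, j d} = k)"
proof -
  have fin: "finite XA" "finite XB" "finite XC"
    using X(2-5) finite_subset by blast+
  have ne: "card XA > 0" "card XB > 0"
  proof -
    have "0 < q * n" using assms(9,10) by simp
    then show "card XA > 0" using assms(11) by linarith
    then have "0 < q * card XA ^ n * n" using assms(9,10) by simp
    then show "card XB > 0" using assms(12) by linarith
  qed
  let ?L1 = "{..<q} \<times> ({..<n} \<rightarrow>\<^sub>E XA)"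
  let ?L2 = "?L1 \<times> ({..<n} \<rightarrow>\<^sub>E XB)"
  have L: "finite ?L1" "finite ?L2" "card ?L1 = q * card XA ^ n"
    "card ?L2 = q * card XA ^ n * card XB ^ n"
    using fin by (simp_all add: finite_PiE card_funcsetE card_cartesian_product)
  have "card ?L1 > 0" "card ?L2 > 0" unfolding L(3,4) using ne assms(9) by simp_all
  then have Lne: "?L1 \<noteq> {}" "?L2 \<noteq> {}" by (auto simp only: card.empty)
  have "\<exists>p\<in>?L1. inj_on (snd p) {..<n} \<and> (\<forall>a\<in>{..<n}. c {snd p a, y, z} = fst p)"
    if yz: "y \<in> XB" "z \<in> XC" for y z
  proof -
    have "(\<lambda>x. c {x, y, z}) \<in> XA \<rightarrow> {..<q}"
    proof
      fix x assume "x \<in> XA"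
      then have "c {x, y, z} < q"
        using yz X(3-8) by (intro color_triple[OF X(1)]) auto
      then show "c {x, y, z} \<in> {..<q}" by simp
    qed
    then have "\<exists>l\<in>{..<q}. \<exists>f\<in>{..<n} \<rightarrow>\<^sub>E XA. inj_on f {..<n} \<and> (\<forall>v\<in>{..<n}. c {f v, y, z} = l)"
      using assms(9,11) fin by (intro constant_embedding) auto
    then obtain l f where "(l, f) \<in> ?L1" "inj_on f {..<n}" "\<forall>v\<in>{..<n}. c {f v, y, z} = l" by blast
    then show ?thesis by (intro bexI[of _ "(l, f)"]) simp_all
  qed
  then have "\<forall>y\<in>XB. \<forall>z\<in>XC. \<exists>p. p \<in> ?L1 \<and> inj_on (snd p) {..<n} \<and>
      (\<forall>a\<in>{..<n}. c {snd p a, y, z} = fst p)" by blast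
  then obtain D1 where D1: "\<And>y z. y \<in> XB \<Longrightarrow> z \<in> XC \<Longrightarrow> D1 y z \<in> ?L1 \<and>
      inj_on (snd (D1 y z)) {..<n} \<and> (\<forall>a\<in>{..<n}. c {snd (D1 y z) a, y, z} = fst (D1 y z))"
    unfolding bchoice_iff by blast
  have "\<exists>p\<in>?L2. inj_on (snd p) {..<n} \<and> (\<forall>b\<in>{..<n}. D1 (snd p b) z = fst p)" if z: "z \<in> XC" for z
  proof -
    have "(\<lambda>y. D1 y z) \<in> XB \<rightarrow> ?L1" using D1 z by blast
    then have "\<exists>l\<in>?L1. \<exists>f\<in>{..<n} \<rightarrow>\<^sub>E XB. inj_on f {..<n} \<and> (\<forall>v\<in>{..<n}. D1 (f v) z = l)"
      using assms(12) fin(2) L(1) Lne(1) unfolding L(3)[symmetric]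
      by (intro constant_embedding) simp_all
    then obtain l f where "(l, f) \<in> ?L2" "inj_on f {..<n}" "\<forall>v\<in>{..<n}. D1 (f v) z = l" by blast
    then show ?thesis by (intro bexI[of _ "(l, f)"]) simp_all
  qed
  then obtain D2 where D2: "\<And>z. z \<in> XC \<Longrightarrow> D2 z \<in> ?L2 \<and> inj_on (snd (D2 z)) {..<n} \<and>
      (\<forall>b\<in>{..<n}. D1 (snd (D2 z) b) z = fst (D2 z))"
    by metis
  have "D2 \<in> XC \<rightarrow> ?L2" using D2 by blast
  then have "\<exists>l\<in>?L2. \<exists>f\<in>{..<n} \<rightarrow>\<^sub>E XC. inj_on f {..<n} \<and> (\<forall>v\<in>{..<n}. D2 (f v) = l)"
    using assms(13) fin(3) L(2) Lne(2) unfolding L(4)[symmetric]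
    by (intro constant_embedding) simp_all
  then obtain k f h j where kf: "k < q" "f \<in> {..<n} \<rightarrow>\<^sub>E XA" "h \<in> {..<n} \<rightarrow>\<^sub>E XB"
    and j: "j \<in> {..<n} \<rightarrow>\<^sub>E XC" "inj_on j {..<n}" "\<forall>v\<in>{..<n}. D2 (j v) = ((k, f), h)"
    by auto
  have jm: "j d \<in> XC" if "d < n" for d using that j(1) by auto
  have hm: "h b \<in> XB" if "b < n" for b using that kf(3) by auto
  have D2j: "inj_on h {..<n} \<and> (\<forall>b\<in>{..<n}. D1 (h b) (j d) = (k, f))" if "d < n" for d
    using D2[OF jm[OF that]] j(3) that by simp
  have D1j: "inj_on f {..<n} \<and> (\<forall>a\<in>{..<n}. c {f a, h b, j d} = k)" if "d < n" "b < n" for b d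
    using D1[OF hm[OF that(2)] jm[OF that(1)]] D2j[OF that(1)] that(2) by simp
  \<comment> \<open>As \<open>n\<close> is positive there is an index at which these facts can be
    read off from the labels.\<close>
  have "inj_on h {..<n}" "inj_on f {..<n}"
    using D2j[OF assms(10)] D1j[OF assms(10) assms(10)] by blast+
  moreover have "\<forall>a<n. \<forall>b<n. \<forall>d<n. c {f a, h b, j d} = k" using D1j by simp
  ultimately show ?thesis using kf j(1,2) by blast
qed

lemma inj_into_lessThan:
  assumes "finite A" "card A \<le> n"
  obtains i :: "'a \<Rightarrow> nat" where "inj_on i A" "\<And>x. x \<in> A \<Longrightarrow> i x < n"
proof -
  have "\<exists>i. i ` A \<subseteq> {..<n} \<and> inj_on i A"
    using assms by (intro card_le_inj) simp_all
  then show thesis using that by auto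
qed

lemma inj_on_factor:
  assumes "inj_on i A" "\<And>x. x \<in> A \<Longrightarrow> i x < n" "inj_on f {..<n}" "\<And>x. x \<in> A \<Longrightarrow> \<phi> x = f (i x)"
  shows "inj_on \<phi> A"
proof (rule inj_onI)
  fix x y assume xy: "x \<in> A" "y \<in> A" "\<phi> x = \<phi> y"
  then have "f (i x) = f (i y)" using assms(4) by simp
  then have "i x = i y" using assms(2) xy by (intro inj_onD[OF assms(3)]) simp_all
  then show "x = y" using inj_onD[OF assms(1)] xy by blast
qed

text \<open>\<open>G\<close> embeds into the complete tripartite hypergraph with parts of size
  \<open>n\<close>, as \<open>n\<close> bounds the size of each part of \<open>G\<close>.\<close>

lemma forces_tripartite:
  assumes G: "three_graph G" "tripartite G"
  shows "\<exists>b. \<forall>q\<ge>2. forces (\<lambda>_. G) q (q ^ b)"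
proof -
  obtain A B C where ABC: "A \<union> B \<union> C = verts G" "A \<inter> B = {}" "A \<inter> C = {}" "B \<inter> C = {}"
    "\<And>e. e \<in> edges G \<Longrightarrow> card (e \<inter> A) = 1 \<and> card (e \<inter> B) = 1 \<and> card (e \<inter> C) = 1"
    using G(2) unfolding tripartite_def by blast
  have finV: "finite (verts G)" using G(1) unfolding three_graph_def by blast
  then have fin: "finite A" "finite B" "finite C" using ABC(1) by (metis finite_Un)+
  \<comment> \<open>The \<open>Suc\<close> makes \<open>n\<close> positive.\<close>
  define n where "n = Suc (card (verts G))"
  have cardn: "card A \<le> n" "card B \<le> n" "card C \<le> n"
    using ABC(1) card_mono[OF finV, of A] card_mono[OF finV, of B] card_mono[OF finV, of C]
    unfolding n_def by fastforce+
  obtain iA iB iC :: "'a \<Rightarrow> nat" where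
    iA: "inj_on iA A" "\<And>x. x \<in> A \<Longrightarrow> iA x < n" and
    iB: "inj_on iB B" "\<And>x. x \<in> B \<Longrightarrow> iB x < n" and
    iC: "inj_on iC C" "\<And>x. x \<in> C \<Longrightarrow> iC x < n"
    using inj_into_lessThan[OF fin(1) cardn(1)] inj_into_lessThan[OF fin(2) cardn(2)]
      inj_into_lessThan[OF fin(3) cardn(3)] by metis
  \<comment> \<open>\<open>q ^ b1\<close> and \<open>q ^ b2\<close> are the numbers of labels in the
    second and third pigeonhole when the first two blocks have sizes \<open>q ^ (1 + n)\<close> and
    \<open>q ^ (b1 + n)\<close>; the factor \<open>q ^ n\<close> bounds \<open>n\<close>.\<close>
  define b1 where "b1 = 1 + (1 + n) * n"
  define b2 where "b2 = b1 + (b1 + n) * n"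
  \<comment> \<open>The three blocks together have at most \<open>4 * q ^ (b2 + n)\<close> elements,
    and 4 is at most \<open>q ^ 2\<close>.\<close>
  have "forces (\<lambda>_. G) q (q ^ (b2 + n + 2))" if q: "q \<ge> 2" for q
    unfolding forces_def
  proof (intro allI impI)
    fix X c assume X: "finite X" "q ^ (b2 + n + 2) \<le> card X" "coloring X q c"
    have nq: "n \<le> q ^ n" using le_power_self[OF q] .
    have pw: "q ^ a \<le> q ^ b" if "a \<le> b" for a b using that q by (intro power_increasing) auto
    have "q ^ (1 + n) + (q ^ (b1 + n) + q ^ (b2 + n)) \<le> 4 * q ^ (b2 + n)"
    proof -
      have "q ^ (1 + n) \<le> q ^ (b2 + n)" "q ^ (b1 + n) \<le> q ^ (b2 + n)"
        by (rule pw; simp add: b2_def b1_def)+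
      then show ?thesis by linarith
    qed
    also have "\<dots> \<le> q ^ 2 * q ^ (b2 + n)"
      using power_mono[of 2 q 2] q by simp
    also have "\<dots> = q ^ (b2 + n + 2)" by (simp add: power_add power2_eq_square)
    finally have tot: "q ^ (1 + n) + (q ^ (b1 + n) + q ^ (b2 + n)) \<le> card X" using X(2) by linarith
    obtain XA Y where XA: "XA \<subseteq> X" "Y \<subseteq> X" "XA \<inter> Y = {}" "card XA = q ^ (1 + n)"
      "q ^ (b1 + n) + q ^ (b2 + n) \<le> card Y"
      using split_card[OF X(1) tot] by metis
    have "finite Y" using XA(2) X(1) finite_subset by blast
    then obtain XB XC where XB: "XB \<subseteq> Y" "XC \<subseteq> Y" "XB \<inter> XC = {}" "card XB = q ^ (b1 + n)"
      "q ^ (b2 + n) \<le> card XC"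
      using split_card[OF _ XA(5)] by metis
    have e1: "q * card XA ^ n = q ^ b1"
      unfolding XA(4) b1_def power_add power_mult by simp
    have e2: "q ^ b1 * card XB ^ n = q ^ b2"
      unfolding XB(4) b2_def power_add power_mult by simp
    have "\<exists>k<q. \<exists>f h j. f \<in> {..<n} \<rightarrow>\<^sub>E XA \<and> inj_on f {..<n} \<and> h \<in> {..<n} \<rightarrow>\<^sub>E XB \<and> inj_on h {..<n} \<and>
      j \<in> {..<n} \<rightarrow>\<^sub>E XC \<and> inj_on j {..<n} \<and> (\<forall>a<n. \<forall>b<n. \<forall>d<n. c {f a, h b, j d} = k)"
    proof (rule color_tripartite[OF X(3,1)])
      show "q * n \<le> card XA" unfolding XA(4) using nq by simp
      show "q * card XA ^ n * n \<le> card XB" unfolding e1 XB(4) power_add using nq by simp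
      have "q ^ b2 * n \<le> q ^ (b2 + n)" unfolding power_add using nq by simp
      then show "q * card XA ^ n * card XB ^ n * n \<le> card XC"
        unfolding e1 e2 using XB(5) by linarith
      show "n > 0" "q > 0" using q unfolding n_def by simp_all
      show "XA \<subseteq> X" "XB \<subseteq> X" "XC \<subseteq> X" "XA \<inter> XB = {}" "XA \<inter> XC = {}" "XB \<inter> XC = {}"
        using XA(1-3) XB(1-3) by blast+
    qed
    then obtain k f h j where k: "k < q"
      and f: "f \<in> {..<n} \<rightarrow>\<^sub>E XA" "inj_on f {..<n}"
      and h: "h \<in> {..<n} \<rightarrow>\<^sub>E XB" "inj_on h {..<n}"
      and j: "j \<in> {..<n} \<rightarrow>\<^sub>E XC" "inj_on j {..<n}"
      and col: "\<forall>a<n. \<forall>b<n. \<forall>d<n. c {f a, h b, j d} = k"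
      by (elim exE conjE)
    have mem: "\<And>a. a < n \<Longrightarrow> f a \<in> XA" "\<And>a. a < n \<Longrightarrow> h a \<in> XB" "\<And>a. a < n \<Longrightarrow> j a \<in> XC"
      using f(1) h(1) j(1) by auto
    define \<phi> where "\<phi> v = (if v \<in> A then f (iA v) else if v \<in> B then h (iB v) else j (iC v))" for v
    have \<phi>: "\<And>v. v \<in> A \<Longrightarrow> \<phi> v = f (iA v)" "\<And>v. v \<in> B \<Longrightarrow> \<phi> v = h (iB v)"
      "\<And>v. v \<in> C \<Longrightarrow> \<phi> v = j (iC v)"
      unfolding \<phi>_def using ABC(2-4) by auto
    have im: "\<And>v. v \<in> A \<Longrightarrow> \<phi> v \<in> XA" "\<And>v. v \<in> B \<Longrightarrow> \<phi> v \<in> XB" "\<And>v. v \<in> C \<Longrightarrow> \<phi> v \<in> XC"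
      using \<phi> mem iA(2) iB(2) iC(2) by simp_all
    have "inj_on \<phi> A" "inj_on \<phi> B" "inj_on \<phi> C"
      using inj_on_factor[OF iA f(2) \<phi>(1)] inj_on_factor[OF iB h(2) \<phi>(2)]
        inj_on_factor[OF iC j(2) \<phi>(3)] by simp_all
    moreover have img: "\<phi> ` A \<subseteq> XA" "\<phi> ` B \<subseteq> XB" "\<phi> ` C \<subseteq> XC"
      using im by (simp_all add: image_subset_iff)
    moreover have "XA \<inter> XB = {}" "XA \<inter> XC = {}" using XA(3) XB(1,2) by blast+
    ultimately have "inj_on \<phi> (A \<union> B)" "\<phi> ` (A \<union> B) \<inter> \<phi> ` C = {}" "inj_on \<phi> C"
      using XB(3) by (simp_all only: inj_on_Un image_Un) blast+
    then have "inj_on \<phi> (A \<union> B \<union> C)"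
      unfolding inj_on_Un[of _ "A \<union> B" C] by blast
    then have "inj_on \<phi> (verts G)" unfolding ABC(1) .
    moreover have "\<phi> ` verts G \<subseteq> X"
    proof -
      have "\<phi> ` A \<subseteq> X" "\<phi> ` B \<subseteq> X" "\<phi> ` C \<subseteq> X"
        using img XA(1,2) XB(1,2) by (meson subset_trans)+
      then show ?thesis unfolding ABC(1)[symmetric] image_Un by simp
    qed
    moreover have "c (\<phi> ` e) = k" if e: "e \<in> edges G" for e
    proof -
      obtain x y z where xyz: "e \<inter> A = {x}" "x \<in> A" "e \<inter> B = {y}" "y \<in> B" "e \<inter> C = {z}" "z \<in> C"
        using ABC(5)[OF e] card_Int_1E[of e A] card_Int_1E[of e B] card_Int_1E[of e C] by metis
      have "e \<subseteq> A \<union> B \<union> C" using three_graph_finite_edge(2)[OF G(1) e] ABC(1) by simp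
      then have "e = (e \<inter> A) \<union> (e \<inter> B) \<union> (e \<inter> C)" by blast
      also have "\<dots> = {x, y, z}" unfolding xyz(1,3,5) by auto
      finally have "\<phi> ` e = {f (iA x), h (iB y), j (iC z)}" using \<phi> xyz by simp
      then show ?thesis using col iA(2) iB(2) iC(2) xyz by simp
    qed
    ultimately show "\<exists>k<q. mono_embeds G X c k"
      using k unfolding mono_embeds_def by blast
  qed
  then show ?thesis by blast
qed

section \<open>The class \<open>\<U>\<^sub>1\<close>\<close>

text \<open>Each \<open>s\<close> in \<open>XS\<close> colours the pairs of \<open>XT\<close> and so
  determines a clique of size \<open>n\<close> in some colour. This colour and an enumeration of the
  clique form the label of \<open>s\<close>, and \<open>n\<close> of the vertices \<open>s\<close>
  share a label.\<close>

lemma color_cone: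
  assumes X: "coloring X q c" "finite X" "XT \<subseteq> X" "XS \<subseteq> X" "XT \<inter> XS = {}"
    and "q > 0" "(q + 1) ^ (q * n) \<le> card XT" "q * card XT ^ n * n \<le> card XS"
  shows "\<exists>k<q. \<exists>f h. f \<in> {..<n} \<rightarrow>\<^sub>E XT \<and> inj_on f {..<n} \<and> h \<in> {..<n} \<rightarrow>\<^sub>E XS \<and> inj_on h {..<n} \<and>
    (\<forall>a<n. \<forall>b<n. \<forall>d<n. a \<noteq> b \<longrightarrow> c {h d, f a, f b} = k)"
proof (cases "n = 0")
  case True
  then show ?thesis using assms(6) by (intro exI[of _ 0] exI[of _ "\<lambda>_. undefined"]) simp
next
  case False
  have fin: "finite XT" "finite XS" using X(2-4) finite_subset by blast+
  let ?L = "{..<q} \<times> ({..<n} \<rightarrow>\<^sub>E XT)"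
  have L: "finite ?L" "card ?L = q * card XT ^ n"
    using fin by (simp_all add: finite_PiE card_funcsetE card_cartesian_product)
  have "\<exists>p\<in>?L. inj_on (snd p) {..<n} \<and> (\<forall>a<n. \<forall>b<n. a \<noteq> b \<longrightarrow> c {s, snd p a, snd p b} = fst p)"
    if s: "s \<in> XS" for s
  proof -
    have "\<exists>k<q. \<exists>T\<subseteq>XT. card T = n \<and> (\<forall>x\<in>T. \<forall>y\<in>T. x \<noteq> y \<longrightarrow> c (insert s {x, y}) = k)"
    proof (rule ramsey_pairs[where n = "\<lambda>_. n" and \<chi> = "\<lambda>e. c (insert s e)"])
      show "c (insert s {x, y}) < q" if "x \<in> XT" "y \<in> XT" "x \<noteq> y" for x y
        using that s X(3-5) by (intro color_triple[OF X(1)]) auto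
    qed (use fin assms(6,7) in simp_all)
    then obtain k T where k: "k < q" and T: "T \<subseteq> XT" "card T = n"
      "\<And>x y. x \<in> T \<Longrightarrow> y \<in> T \<Longrightarrow> x \<noteq> y \<Longrightarrow> c {s, x, y} = k" by auto
    have "finite T" using T(1) fin(1) finite_subset by blast
    then obtain f where f: "f ` {..<n} \<subseteq> T" "inj_on f {..<n}"
      using card_le_inj[of "{..<n}" T] T(2) by auto
    let ?p = "(k, restrict f {..<n})"
    have "?p \<in> ?L" using k f(1) T(1) by auto
    moreover have "inj_on (restrict f {..<n}) {..<n}" using f(2) by simp
    moreover have "c {s, f a, f b} = k" if "a < n" "b < n" "a \<noteq> b" for a b
      using that f by (intro T(3)) (auto simp: inj_on_eq_iff)
    ultimately show ?thesis by (intro bexI[of _ ?p]) simp_all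
  qed
  then obtain D where D: "\<And>s. s \<in> XS \<Longrightarrow> D s \<in> ?L \<and> inj_on (snd (D s)) {..<n} \<and>
      (\<forall>a<n. \<forall>b<n. a \<noteq> b \<longrightarrow> c {s, snd (D s) a, snd (D s) b} = fst (D s))"
    by metis
  have "0 < (q + 1) ^ (q * n)" by simp
  then have "card XT > 0" using assms(7) by linarith
  then have "card ?L > 0" unfolding L(2) using assms(6) by simp
  then have "?L \<noteq> {}" by (auto simp only: card.empty)
  moreover have "D \<in> XS \<rightarrow> ?L" using D by blast
  ultimately have "\<exists>l\<in>?L. \<exists>f\<in>{..<n} \<rightarrow>\<^sub>E XS. inj_on f {..<n} \<and> (\<forall>v\<in>{..<n}. D (f v) = l)"
    using assms(8) fin(2) L(1) unfolding L(2)[symmetric]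
    by (intro constant_embedding) simp_all
  then obtain k f h where kf: "k < q" "f \<in> {..<n} \<rightarrow>\<^sub>E XT"
    and h: "h \<in> {..<n} \<rightarrow>\<^sub>E XS" "inj_on h {..<n}" "\<forall>v\<in>{..<n}. D (h v) = (k, f)"
    by auto
  have hm: "h d \<in> XS" if "d < n" for d using that h(1) by auto
  have *: "inj_on f {..<n} \<and> (\<forall>a<n. \<forall>b<n. a \<noteq> b \<longrightarrow> c {h d, f a, f b} = k)" if "d < n" for d
    using D[OF hm[OF that]] h(3) that by simp
  then have "inj_on f {..<n}" using False by blast
  moreover have "\<forall>a<n. \<forall>b<n. \<forall>d<n. a \<noteq> b \<longrightarrow> c {h d, f a, f b} = k" using * by simp
  ultimately show ?thesis using kf h(1,2) by blast
qed

lemma edge_in_U1: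
  assumes "card e = 3" "card (e \<inter> S) = 1"
  obtains s x y where "e = {s, x, y}" "s \<in> S" "x \<notin> S" "y \<notin> S" "x \<noteq> y"
proof -
  obtain s where s: "e \<inter> S = {s}" using assms(2) card_Int_1E by metis
  have "finite e" using assms(1) by (auto intro: card_ge_0_finite)
  moreover have "s \<in> e" using s by blast
  ultimately have "card (e - {s}) = 2" using assms(1) by simp
  then obtain x y where xy: "e - {s} = {x, y}" "x \<noteq> y" by (auto simp: card_2_iff)
  then have "e = {s, x, y}" using s by auto
  then show thesis using that[of s x y] s xy by auto
qed

text \<open>The set \<open>S\<close> that every edge of \<open>g k\<close> meets once is sent to the
  vertices \<open>h d\<close> of the cone and all other vertices to the clique. A single indexing
  \<open>i\<close> of the vertices suffices for both, because \<open>XS\<close> and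
  \<open>XT\<close> are disjoint.\<close>

lemma forces_U1:
  assumes g: "\<And>k. k < q \<Longrightarrow> g k \<in> U_class (Suc 0)" "\<And>k. k < q \<Longrightarrow> card (verts (g k)) \<le> n"
    and q: "q \<ge> 2"
  shows "forces g q (q ^ ((2 * n * n + 3 * n + 2) * q))"
  unfolding forces_def
proof (intro allI impI)
  fix X c assume X: "finite X" "q ^ ((2 * n * n + 3 * n + 2) * q) \<le> card X" "coloring X q c"
  \<comment> \<open>The size of \<open>XT\<close>: it is at least the pair Ramsey bound
    \<open>(q + 1) ^ (q * n)\<close>, because \<open>q + 1\<close> is at most
    \<open>q ^ 2\<close>.\<close>
  let ?R = "q ^ (2 * q * n)"
  have nq: "n \<le> q ^ n" using le_power_self[OF q] .
  have pw: "q ^ a \<le> q ^ b" if "a \<le> b" for a b using that q by (intro power_increasing) auto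
  have "q * ?R ^ n * n \<le> q * ?R ^ n * q ^ n" using nq by simp
  also have "\<dots> = q ^ (1 + 2 * q * n * n + n)" by (simp add: power_add power_mult)
  also have "\<dots> \<le> q ^ (1 + (2 * n * n + 3 * n) * q)"
    using q by (intro pw) (simp add: algebra_simps)
  finally have 1: "q * ?R ^ n * n \<le> q ^ (1 + (2 * n * n + 3 * n) * q)" .
  have 2: "?R \<le> q ^ (1 + (2 * n * n + 3 * n) * q)"
    by (intro pw) (simp add: algebra_simps)
  have "?R + q * ?R ^ n * n \<le> 2 * q ^ (1 + (2 * n * n + 3 * n) * q)" using 1 2 by linarith
  also have "\<dots> \<le> q * q ^ (1 + (2 * n * n + 3 * n) * q)" using q by (intro mult_right_mono) auto
  also have "\<dots> = q ^ (2 + (2 * n * n + 3 * n) * q)" by simp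
  also have "\<dots> \<le> q ^ ((2 * n * n + 3 * n + 2) * q)"
    using q by (intro pw) (simp add: algebra_simps)
  finally have tot: "?R + q * ?R ^ n * n \<le> card X" using X(2) by linarith
  obtain XT XS where XT: "XT \<subseteq> X" "XS \<subseteq> X" "XT \<inter> XS = {}" "card XT = ?R"
    "q * ?R ^ n * n \<le> card XS"
    using split_card[OF X(1) tot] by metis
  have "q + 1 \<le> 2 * q" using q by simp
  also have "\<dots> \<le> q ^ 2" using q by (simp add: power2_eq_square)
  finally have "(q + 1) ^ (q * n) \<le> (q ^ 2) ^ (q * n)" by (rule power_mono) simp
  then have RT: "(q + 1) ^ (q * n) \<le> card XT"
    unfolding XT(4) by (simp add: power_mult[symmetric] mult.assoc)
  have q0: "q > 0" using q by simp
  have XS: "q * card XT ^ n * n \<le> card XS" unfolding XT(4) by (rule XT(5))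
  obtain k f h where k: "k < q" and f: "f \<in> {..<n} \<rightarrow>\<^sub>E XT" "inj_on f {..<n}"
    and h: "h \<in> {..<n} \<rightarrow>\<^sub>E XS" "inj_on h {..<n}"
    and col: "\<forall>a<n. \<forall>b<n. \<forall>d<n. a \<noteq> b \<longrightarrow> c {h d, f a, f b} = k"
    using color_cone[OF X(3,1) XT(1,2,3) q0 RT XS] by (elim exE conjE)
  have G: "three_graph (g k)" and "\<exists>S\<subseteq>verts (g k). \<forall>e\<in>edges (g k). card (e \<inter> S) = 1"
    using g(1)[OF k] by auto
  then obtain S where S: "S \<subseteq> verts (g k)" "\<And>e. e \<in> edges (g k) \<Longrightarrow> card (e \<inter> S) = 1" by blast
  have finV: "finite (verts (g k))" using G unfolding three_graph_def by blast
  obtain i where i: "inj_on i (verts (g k))" "\<And>x. x \<in> verts (g k) \<Longrightarrow> i x < n"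
    using inj_into_lessThan[OF finV g(2)[OF k]] by metis
  define \<phi> where "\<phi> v = (if v \<in> S then h (i v) else f (i v))" for v
  have im: "\<phi> v \<in> XS" if "v \<in> S" for v
    using that S(1) i(2) h(1) unfolding \<phi>_def by auto
  have im': "\<phi> v \<in> XT" if "v \<in> verts (g k) - S" for v
    using that i(2) f(1) unfolding \<phi>_def by auto
  have "inj_on \<phi> (verts (g k))"
  proof (rule inj_onI)
    fix u v assume uv: "u \<in> verts (g k)" "v \<in> verts (g k)" "\<phi> u = \<phi> v"
    then have "u \<in> S \<longleftrightarrow> v \<in> S" using im im' XT(3) by (metis Diff_iff disjoint_iff)
    then have "i u = i v"
      using uv i(2) inj_onD[OF f(2), of "i u" "i v"] inj_onD[OF h(2), of "i u" "i v"]
      unfolding \<phi>_def by (auto split: if_splits)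
    then show "u = v" using i(1) uv by (auto dest: inj_onD)
  qed
  moreover have "\<phi> ` verts (g k) \<subseteq> X" using im im' XT(1,2) by blast
  moreover have "c (\<phi> ` e) = k" if e: "e \<in> edges (g k)" for e
  proof -
    have e3: "e \<subseteq> verts (g k)" "card e = 3" using three_graph_finite_edge[OF G e] by auto
    obtain s x y where sxy: "e = {s, x, y}" "s \<in> S" "x \<notin> S" "y \<notin> S" "x \<noteq> y"
      using edge_in_U1[OF e3(2) S(2)[OF e]] by metis
    then have "i x \<noteq> i y" using i(1) e3(1) by (auto dest: inj_onD)
    moreover have "i s < n" "i x < n" "i y < n" using sxy(1) e3(1) i(2) by simp_all
    ultimately have "c {h (i s), f (i x), f (i y)} = k" using col by blast
    moreover have "\<phi> ` e = {h (i s), f (i x), f (i y)}" using sxy unfolding \<phi>_def by auto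
    ultimately show ?thesis by simp
  qed
  ultimately show "\<exists>k<q. mono_embeds (g k) X c k"
    using k unfolding mono_embeds_def by blast
qed

section \<open>Collapsing\<close>

text \<open>Send \<open>U\<close> into \<open>W\<close> by \<open>f\<close> and all other vertices
  by \<open>\<phi>\<close>. An edge that misses \<open>U\<close> survives the collapse; an edge with
  a single vertex \<open>u\<close> in \<open>U\<close> becomes an edge through \<open>v\<close>, and
  the copy with \<open>v\<close> placed at \<open>f u\<close> gives its colour; an edge inside
  \<open>U\<close> is coloured by \<open>F\<close>. Collapsibility excludes two vertices in
  \<open>U\<close>. The same copies show that \<open>f u\<close> differs from the images of the
  vertices outside \<open>U\<close>.\<close>

lemma mono_embeds_collapse:
  assumes G: "three_graph G" and U: "collapsible G U" "v \<notin> verts G - U"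
    and emb: "\<And>w. w \<in> W \<Longrightarrow> inj_on (\<phi>(v := w)) (verts (collapse G U v))"
      "\<And>w. w \<in> W \<Longrightarrow> (\<phi>(v := w)) ` verts (collapse G U v) \<subseteq> X"
      "\<And>w e. w \<in> W \<Longrightarrow> e \<in> edges (collapse G U v) \<Longrightarrow> c ((\<phi>(v := w)) ` e) = k"
    and F: "mono_embeds (induced G U) W c k"
  shows "mono_embeds G X c k"
proof -
  obtain f where f: "inj_on f U" "f ` U \<subseteq> W" "\<And>e. e \<in> edges G \<Longrightarrow> e \<subseteq> U \<Longrightarrow> c (f ` e) = k"
    using F unfolding mono_embeds_def induced_def by auto
  have Us: "U \<subseteq> verts G" "card U \<ge> 2" "\<And>e. e \<in> edges G \<Longrightarrow> card (e \<inter> U) \<noteq> 2"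
    using U(1) unfolding collapsible_def by auto
  have H: "verts (collapse G U v) = insert v (verts G - U)" unfolding collapse_def by simp
  \<comment> \<open>Statements that concern only vertices outside \<open>U\<close> are read off from
    the copy with \<open>v\<close> placed at \<open>f u0\<close>.\<close>
  obtain u0 where u0: "u0 \<in> U" using Us(2) by fastforce
  define \<psi> where "\<psi> x = (if x \<in> U then f x else \<phi> x)" for x
  have off: "(\<phi>(v := w)) x = \<psi> x" if "x \<in> verts G - U" for x w
    using that U(2) unfolding \<psi>_def by auto
  have on: "(\<phi>(v := f u)) v = \<psi> u" if "u \<in> U" for u
    using that unfolding \<psi>_def by auto
  have embU: "inj_on (\<phi>(v := f u)) (insert v (verts G - U))"
    "(\<phi>(v := f u)) ` insert v (verts G - U) \<subseteq> X" if "u \<in> U" for u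
    using emb(1,2)[of "f u"] that f(2) unfolding H by auto
  have "inj_on \<psi> (verts G)"
  proof (rule inj_onI)
    fix x y assume xy: "x \<in> verts G" "y \<in> verts G" "\<psi> x = \<psi> y"
    have mixed: False if "x \<in> U" "y \<in> verts G - U" "\<psi> x = \<psi> y" for x y
    proof -
      have "(\<phi>(v := f x)) v = (\<phi>(v := f x)) y" using off[OF that(2)] on[OF that(1)] that(3) by metis
      then have "v = y" using inj_onD[OF embU(1)[OF that(1)]] that(2) by blast
      then show False using that(2) U(2) by simp
    qed
    consider "x \<in> U" "y \<in> U" | "x \<in> U" "y \<notin> U" | "x \<notin> U" "y \<in> U" | "x \<notin> U" "y \<notin> U" by blast
    then show "x = y"
    proof cases
      case 1 then show ?thesis using xy f(1) unfolding \<psi>_def by (auto dest: inj_onD)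
    next
      case 2 then show ?thesis using mixed[of x y] xy by simp
    next
      case 3 then show ?thesis using mixed[of y x] xy by simp
    next
      case 4
      then have "(\<phi>(v := f u0)) x = (\<phi>(v := f u0)) y" using off[of x] off[of y] xy by simp
      then show ?thesis using inj_onD[OF embU(1)[OF u0]] 4 xy(1,2) by blast
    qed
  qed
  moreover have "\<psi> ` verts G \<subseteq> X"
  proof (rule image_subsetI)
    fix x assume x: "x \<in> verts G"
    show "\<psi> x \<in> X"
    proof (cases "x \<in> U")
      case True
      then show ?thesis using embU(2)[OF True] on[OF True] by (metis image_insert insert_subset)
    next
      case False
      then have "(\<phi>(v := f u0)) x \<in> X" using embU(2)[OF u0] x by blast
      then show ?thesis using off[of x] False x by simp
    qed
  qed
  moreover have "c (\<psi> ` e) = k" if e: "e \<in> edges G" for e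
  proof -
    have e3: "finite e" "e \<subseteq> verts G" "card e = 3" using three_graph_finite_edge[OF G e] by auto
    have "card (e \<inter> U) \<le> 3" using card_mono[OF e3(1), of "e \<inter> U"] e3(3) by simp
    then consider "card (e \<inter> U) = 0" | "card (e \<inter> U) = 1" | "card (e \<inter> U) = 3"
      using Us(3)[OF e] by linarith
    then show ?thesis
    proof cases
      case 1
      then have eU: "e \<inter> U = {}" using e3(1) by simp
      then have "e \<in> edges (collapse G U v)" using e unfolding collapse_def by simp
      then have "c ((\<phi>(v := f u0)) ` e) = k" using emb(3) u0 f(2) by blast
      moreover have "(\<phi>(v := f u0)) ` e = \<psi> ` e"
        by (intro image_cong refl off) (use eU e3(2) in blast)
      ultimately show ?thesis by simp
    next
      case 2
      then obtain u x y where uxy: "e = {u, x, y}" "u \<in> U" "x \<notin> U" "y \<notin> U" "x \<noteq> y"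
        using edge_in_U1[OF e3(3)] by metis
      then have xy: "x \<in> verts G - U" "y \<in> verts G - U" using e3(2) by auto
      moreover have "{x, y, u} \<in> edges G" using e uxy(1) by (simp add: insert_commute)
      ultimately have "{x, y, v} \<in> edges (collapse G U v)" using uxy(2) unfolding collapse_def by auto
      then have "c ((\<phi>(v := f u)) ` {x, y, v}) = k" using emb(3) uxy(2) f(2) by blast
      moreover have "(\<phi>(v := f u)) ` {x, y, v} = \<psi> ` e"
      proof -
        have "(\<phi>(v := f u)) ` {x, y, v} = {\<psi> x, \<psi> y, \<psi> u}"
          unfolding image_insert image_empty off[OF xy(1)] off[OF xy(2)] on[OF uxy(2)] ..
        then show ?thesis unfolding uxy(1) by auto
      qed
      ultimately show ?thesis by simp
    next
      case 3
      then have "e \<inter> U = e" using e3 by (intro card_subset_eq) auto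
      then have eU: "e \<subseteq> U" by blast
      then have "\<psi> ` e = f ` e" unfolding \<psi>_def by (intro image_cong) auto
      then show ?thesis using f(3)[OF e eU] by simp
    qed
  qed
  ultimately show ?thesis unfolding mono_embeds_def by blast
qed

text \<open>Among the transversals of \<open>M\<close> blocks of size \<open>q * M ^ m * w\<close>, many contain a copy of the same
  hypergraph with its vertices in the same blocks, and then \<open>w\<close> of these copies differ only in the
  vertex that plays the role of \<open>v k\<close>.\<close>

lemma blow_up_vertex:
  assumes H: "forces h q M" "\<And>k. k < q \<Longrightarrow> three_graph (h k)" "\<And>k. k < q \<Longrightarrow> card (verts (h k)) \<le> m"
    "\<And>k. k < q \<Longrightarrow> v k \<in> verts (h k)"
    and X: "finite X" "coloring X q c" "M * (q * M ^ m * w) \<le> card X" and pos: "w > 0" "M > 0" "q > 0"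
  shows "\<exists>k<q. \<exists>\<phi> W. W \<subseteq> X \<and> w \<le> card W \<and> (\<forall>z\<in>W. inj_on (\<phi>(v k := z)) (verts (h k)) \<and>
    (\<phi>(v k := z)) ` verts (h k) \<subseteq> X \<and> (\<forall>e\<in>edges (h k). c ((\<phi>(v k := z)) ` e) = k))"
proof -
  define n where "n = q * M ^ m * w"
  have "card ({..<M} \<times> {..<n}) \<le> card X" using X(3) unfolding n_def by (simp add: card_cartesian_product)
  \<comment> \<open>\<open>x (i, t)\<close> is element \<open>t\<close> of block \<open>i\<close>; a
    function \<open>y\<close> in \<open>?Y\<close> describes the transversal that takes element
    \<open>y i\<close> from block \<open>i\<close>.\<close>
  then obtain x where x: "x ` ({..<M} \<times> {..<n}) \<subseteq> X" "inj_on x ({..<M} \<times> {..<n})"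
    using card_le_inj[of "{..<M} \<times> {..<n}" X] X(1) by auto
  let ?Y = "{..<M} \<rightarrow>\<^sub>E {..<n}"
  \<comment> \<open>The possible outcomes in a transversal: a colour \<open>k\<close> and the blocks
    that receive the vertices of \<open>h k\<close>.\<close>
  let ?P = "SIGMA k:{..<q}. verts (h k) \<rightarrow>\<^sub>E {..<M}"
  define good where "good y k \<psi> \<longleftrightarrow> inj_on \<psi> (verts (h k)) \<and>
    (\<forall>e\<in>edges (h k). c ((\<lambda>u. x (\<psi> u, y (\<psi> u))) ` e) = k)" for y :: "nat \<Rightarrow> nat" and k and \<psi> :: "'a \<Rightarrow> nat"
  have fin: "finite (verts (h k))" and sub: "\<And>e. e \<in> edges (h k) \<Longrightarrow> e \<subseteq> verts (h k)" if "k < q" for k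
    using H(2)[OF that] unfolding three_graph_def by blast+
  have "\<exists>p\<in>?P. good y (fst p) (snd p)" if y: "y \<in> ?Y" for y
  proof -
    let ?t = "\<lambda>i. x (i, y i)"
    have yn: "y i < n" if "i < M" for i using y that by auto
    have inj: "inj_on ?t {..<M}"
    proof (rule inj_onI)
      fix i j assume "i \<in> {..<M}" "j \<in> {..<M}" "x (i, y i) = x (j, y j)"
      then have "(i, y i) = (j, y j)" using yn by (intro inj_onD[OF x(2)]) auto
      then show "i = j" by simp
    qed
    have sX: "?t ` {..<M} \<subseteq> X" using x(1) yn by (intro image_subsetI) (auto intro!: subsetD[OF x(1)])
    have "M \<le> card (?t ` {..<M})" using card_image[OF inj] by simp
    moreover have "coloring (?t ` {..<M}) q c" using coloring_mono[OF X(2) sX] .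
    ultimately obtain k where k: "k < q" "mono_embeds (h k) (?t ` {..<M}) c k"
      using H(1) unfolding forces_def by blast
    then obtain f where f: "inj_on f (verts (h k))" "f ` verts (h k) \<subseteq> ?t ` {..<M}"
      "\<forall>e\<in>edges (h k). c (f ` e) = k"
      unfolding mono_embeds_def by blast
    define \<psi> where "\<psi> = (\<lambda>u\<in>verts (h k). inv_into {..<M} ?t (f u))"
    have \<psi>: "\<psi> u \<in> {..<M}" "?t (\<psi> u) = f u" if "u \<in> verts (h k)" for u
      using that f(2) inv_into_into[of "f u" ?t "{..<M}"] f_inv_into_f[of "f u" ?t "{..<M}"]
      unfolding \<psi>_def by auto
    have "inj_on \<psi> (verts (h k))"
    proof (rule inj_onI)
      fix a b assume ab: "a \<in> verts (h k)" "b \<in> verts (h k)" "\<psi> a = \<psi> b"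
      then have "f a = f b" using \<psi>(2)[OF ab(1)] \<psi>(2)[OF ab(2)] by metis
      then show "a = b" using f(1) ab by (auto dest: inj_onD)
    qed
    moreover have "c ((\<lambda>u. ?t (\<psi> u)) ` e) = k" if "e \<in> edges (h k)" for e
    proof -
      have "(\<lambda>u. ?t (\<psi> u)) ` e = f ` e"
        using \<psi>(2) sub[OF k(1) that] by (intro image_cong) auto
      then show ?thesis using f(3) that by simp
    qed
    moreover have "\<psi> \<in> verts (h k) \<rightarrow>\<^sub>E {..<M}"
      using \<psi>(1) unfolding \<psi>_def by auto
    ultimately show ?thesis
      using k(1) by (intro bexI[of _ "(k, \<psi>)"]) (auto simp: good_def)
  qed
  then obtain p where p: "\<And>y. y \<in> ?Y \<Longrightarrow> p y \<in> ?P \<and> good y (fst (p y)) (snd (p y))"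
    by metis
  have finP: "finite ?P" using fin by (auto intro!: finite_PiE)
  have cardP: "card ?P \<le> q * M ^ m"
  proof -
    have "card ?P = (\<Sum>k<q. card (verts (h k) \<rightarrow>\<^sub>E {..<M}))"
      using fin by (intro card_SigmaI) (auto intro!: finite_PiE)
    also have "\<dots> \<le> (\<Sum>k<q. M ^ m)"
    proof (rule sum_mono)
      fix k assume "k \<in> {..<q}"
      then have "card (verts (h k) \<rightarrow>\<^sub>E {..<M}) = M ^ card (verts (h k))"
        using fin by (simp add: card_funcsetE)
      also have "\<dots> \<le> M ^ m" using H(3) pos \<open>k \<in> {..<q}\<close> by (intro power_increasing) auto
      finally show "card (verts (h k) \<rightarrow>\<^sub>E {..<M}) \<le> M ^ m" .
    qed
    finally show ?thesis by simp
  qed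
  have npos: "n > 0" unfolding n_def using pos by simp
  \<comment> \<open>There are \<open>n ^ M\<close> transversals and at most \<open>q * M ^ m\<close>
    outcomes. The block size \<open>n\<close> is chosen such that some outcome occurs at least
    \<open>w * n ^ (M - 1)\<close> times.\<close>
  have "card ?P * (w * n ^ (M - 1)) \<le> q * M ^ m * (w * n ^ (M - 1))"
    using cardP by (rule mult_right_mono) simp
  also have "\<dots> = n * n ^ (M - 1)" unfolding n_def by simp
  also have "\<dots> = n ^ M" using pos(2) by (simp add: power_eq_if)
  also have "\<dots> = card ?Y" by (simp add: card_funcsetE)
  finally have card1: "card ?P * (w * n ^ (M - 1)) \<le> card ?Y" .
  have finY: "finite ?Y" by (intro finite_PiE) auto
  have "?Y \<noteq> {}" using npos by (auto simp: PiE_eq_empty_iff)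
  then have "?P \<noteq> {}" using p by blast
  moreover have "p \<in> ?Y \<rightarrow> ?P" using p by blast
  ultimately obtain k\<psi> where k\<psi>: "k\<psi> \<in> ?P" "w * n ^ (M - 1) \<le> card {y\<in>?Y. p y = k\<psi>}"
    using pigeonhole_fibre[OF finY finP _ _ card1] by blast
  obtain k \<psi> where kp: "k\<psi> = (k, \<psi>)" by (cases k\<psi>)
  have k: "k < q" and \<psi>: "\<psi> \<in> verts (h k) \<rightarrow>\<^sub>E {..<M}" using k\<psi>(1) kp by auto
  let ?Y1 = "{y\<in>?Y. p y = k\<psi>}" and ?j = "\<psi> (v k)"
  have good: "good y k \<psi>" if "y \<in> ?Y1" for y using p[of y] that kp by simp
  have j: "?j < M" using \<psi> H(4)[OF k] by auto
  \<comment> \<open>The choices outside the block of \<open>v k\<close>. There are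
    \<open>n ^ (M - 1)\<close> of them, so one is shared by at least \<open>w\<close> transversals
    with the chosen outcome.\<close>
  let ?Q = "({..<M} - {?j}) \<rightarrow>\<^sub>E {..<n}"
  have "card ?Q = n ^ (M - 1)" using j by (simp add: card_funcsetE)
  then have card2: "card ?Q * w \<le> card ?Y1" using k\<psi>(2) by (simp add: mult.commute)
  have finQ: "finite ?Y1" "finite ?Q" "?Q \<noteq> {}"
    using finY npos by (auto intro!: finite_PiE simp: PiE_eq_empty_iff)
  have resQ: "(\<lambda>y. restrict y ({..<M} - {?j})) \<in> ?Y1 \<rightarrow> ?Q"
  proof
    fix y assume "y \<in> ?Y1"
    then have "y \<in> ?Y" by blast
    then show "restrict y ({..<M} - {?j}) \<in> ?Q" unfolding restrict_PiE_iff by (auto simp: PiE_iff)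
  qed
  obtain r where r: "w \<le> card {y\<in>?Y1. restrict y ({..<M} - {?j}) = r}"
    using pigeonhole_fibre[OF finQ resQ card2] by (elim bexE)
  let ?Y2 = "{y\<in>?Y1. restrict y ({..<M} - {?j}) = r}"
  have Y2: "y \<in> ?Y" "y \<in> ?Y1" if "y \<in> ?Y2" for y
    using that by blast+
  have Y2r: "y i = r i" if y: "y \<in> ?Y2" and i: "i < M" "i \<noteq> ?j" for y i
  proof -
    have "restrict y ({..<M} - {?j}) = r" using y by blast
    then have "restrict y ({..<M} - {?j}) i = r i" by (rule fun_cong)
    then show ?thesis using i by simp
  qed
  \<comment> \<open>The value at \<open>v k\<close> is meaningless, since \<open>r\<close> makes no
    choice in block \<open>?j\<close>; it is always overwritten by some \<open>z\<close> in
    \<open>W\<close>.\<close>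
  define \<phi> where "\<phi> u = x (\<psi> u, r (\<psi> u))" for u
  define W where "W = (\<lambda>y. x (?j, y ?j)) ` ?Y2"
  have inW: "x (?j, y ?j) \<in> X" if "y \<in> ?Y2" for y
    using Y2(1)[OF that] j x(1) by (auto intro!: subsetD[OF x(1)])
  have "inj_on (\<lambda>y. x (?j, y ?j)) ?Y2"
  proof (rule inj_onI)
    fix y y' assume y: "y \<in> ?Y2" "y' \<in> ?Y2" "x (?j, y ?j) = x (?j, y' ?j)"
    have "y ?j < n" "y' ?j < n" using Y2(1)[OF y(1)] Y2(1)[OF y(2)] j by auto
    then have "(?j, y ?j) = (?j, y' ?j)" using j y(3) by (intro inj_onD[OF x(2)]) auto
    then have "y i = y' i" if "i < M" for i
      using Y2r[OF y(1) that] Y2r[OF y(2) that] by (cases "i = ?j") simp_all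
    then show "y = y'" by (intro PiE_ext[OF Y2(1)[OF y(1)] Y2(1)[OF y(2)]]) simp
  qed
  then have "w \<le> card W" unfolding W_def using r card_image by fastforce
  moreover have "W \<subseteq> X" unfolding W_def using inW by blast
  moreover have "inj_on (\<phi>(v k := z)) (verts (h k)) \<and> (\<phi>(v k := z)) ` verts (h k) \<subseteq> X \<and>
    (\<forall>e\<in>edges (h k). c ((\<phi>(v k := z)) ` e) = k)" if z: "z \<in> W" for z
  proof -
    obtain y where y: "y \<in> ?Y2" "z = x (?j, y ?j)" using z unfolding W_def by (elim imageE)
    have g: "inj_on \<psi> (verts (h k))" "\<And>e. e \<in> edges (h k) \<Longrightarrow> c ((\<lambda>u. x (\<psi> u, y (\<psi> u))) ` e) = k"
      using good[OF Y2(2)[OF y(1)]] unfolding good_def by blast+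
    have \<psi>M: "\<psi> u < M" if "u \<in> verts (h k)" for u using that \<psi> by auto
    have eq: "(\<phi>(v k := z)) u = x (\<psi> u, y (\<psi> u))" if u: "u \<in> verts (h k)" for u
    proof (cases "u = v k")
      case False
      then have "\<psi> u \<noteq> ?j" using g(1) u H(4)[OF k] by (auto dest: inj_onD)
      then show ?thesis using Y2r[OF y(1) \<psi>M[OF u]] False unfolding \<phi>_def by simp
    qed (simp add: y(2))
    have yn: "y i < n" if "i < M" for i using Y2(1)[OF y(1)] that by auto
    have "inj_on (\<phi>(v k := z)) (verts (h k))"
    proof (rule inj_onI)
      fix a b assume ab: "a \<in> verts (h k)" "b \<in> verts (h k)" "(\<phi>(v k := z)) a = (\<phi>(v k := z)) b"
      then have "x (\<psi> a, y (\<psi> a)) = x (\<psi> b, y (\<psi> b))" using eq[OF ab(1)] eq[OF ab(2)] by metis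
      then have "(\<psi> a, y (\<psi> a)) = (\<psi> b, y (\<psi> b))"
        using \<psi>M[OF ab(1)] \<psi>M[OF ab(2)] yn by (intro inj_onD[OF x(2)]) auto
      then show "a = b" using g(1) ab by (auto dest: inj_onD)
    qed
    moreover have "(\<phi>(v k := z)) ` verts (h k) \<subseteq> X"
    proof (rule image_subsetI)
      fix u assume u: "u \<in> verts (h k)"
      then have "x (\<psi> u, y (\<psi> u)) \<in> X" using \<psi>M yn by (auto intro!: subsetD[OF x(1)])
      then show "(\<phi>(v k := z)) u \<in> X" unfolding eq[OF u] .
    qed
    moreover have "c ((\<phi>(v k := z)) ` e) = k" if "e \<in> edges (h k)" for e
    proof -
      have "(\<phi>(v k := z)) ` e = (\<lambda>u. x (\<psi> u, y (\<psi> u))) ` e"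
        by (intro image_cong refl eq) (use sub[OF k that] in blast)
      then show ?thesis using g(2)[OF that] by simp
    qed
    ultimately show ?thesis by blast
  qed
  ultimately show ?thesis using k by blast
qed

lemma three_graph_no_verts:
  assumes "three_graph G" "verts G = {}"
  shows "edges G = {}"
proof (rule ccontr)
  assume "edges G \<noteq> {}"
  then obtain e where "e \<in> edges G" by blast
  then have "e \<subseteq> {}" "card e = 3" using assms unfolding three_graph_def by metis+
  then show False by simp
qed

lemma mono_embeds_no_verts: "three_graph G \<Longrightarrow> verts G = {} \<Longrightarrow> mono_embeds G X c k"
  unfolding mono_embeds_def using three_graph_no_verts[of G] by simp

text \<open>If colour \<open>k\<close> contains a copy of \<open>H\<close> with its collapsed vertex blown up to a set \<open>W\<close>, then a copy
  of \<open>F\<close> of colour \<open>k\<close> inside \<open>W\<close> completes a copy of the hypergraph assigned to colour \<open>k\<close>. So inside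
  \<open>W\<close> this hypergraph may be replaced by \<open>F\<close>, and the total number of vertices drops.\<close>

lemma forces_collapse:
  assumes D: "\<And>G. G \<in> D \<Longrightarrow> three_graph G"
      "\<And>G. G \<in> D \<Longrightarrow> Hs G = G \<or> (\<exists>F\<in>D. reducible_to G (Hs G) F)"
      "\<And>G. G \<in> D \<Longrightarrow> three_graph (Hs G)" "\<And>G. G \<in> D \<Longrightarrow> card (verts (Hs G)) \<le> m"
    and H: "\<And>g. \<forall>k<q. g k \<in> D \<Longrightarrow> forces (\<lambda>k. Hs (g k)) q M" and pos: "M > 0" "q > 0"
    and g: "\<forall>k<q. g k \<in> D" "(\<Sum>k<q. card (verts (g k))) \<le> p"
  shows "forces g q ((M * (q * M ^ m)) ^ p * M)"
  using g
proof (induction p arbitrary: g)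
  case 0
  \<comment> \<open>No vertices are left in any colour, and the empty hypergraph embeds
    trivially.\<close>
  then have "card (verts (g 0)) = 0" "three_graph (g 0)" using D(1) pos(2) by simp_all
  then have "verts (g 0) = {}" unfolding three_graph_def by simp
  then show ?case
    using mono_embeds_no_verts[OF \<open>three_graph (g 0)\<close>] pos(2) unfolding forces_def by blast
next
  case (Suc p)
  let ?B = "M * (q * M ^ m)"
  let ?w = "?B ^ p * M"
  show ?case
    unfolding forces_def
  proof (intro allI impI)
    fix X c assume X: "finite X" "?B ^ Suc p * M \<le> card X" "coloring X q c"
    show "\<exists>k<q. mono_embeds (g k) X c k"
    proof (cases "\<exists>k<q. verts (g k) = {}")
      case True
      then show ?thesis using mono_embeds_no_verts D(1) Suc.prems(1) by blast
    next
      case ne: False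
      define R where "R k = (SOME Uv. collapsible (g k) (fst Uv) \<and> snd Uv \<notin> verts (g k) - fst Uv \<and>
        Hs (g k) = collapse (g k) (fst Uv) (snd Uv) \<and> induced (g k) (fst Uv) \<in> D)" for k
      have R: "collapsible (g k) (fst (R k)) \<and> snd (R k) \<notin> verts (g k) - fst (R k) \<and>
        Hs (g k) = collapse (g k) (fst (R k)) (snd (R k)) \<and> induced (g k) (fst (R k)) \<in> D"
        if k: "k < q" "Hs (g k) \<noteq> g k" for k
      proof -
        obtain F where "F \<in> D" "reducible_to (g k) (Hs (g k)) F"
          using D(2)[of "g k"] Suc.prems(1) k by blast
        then obtain U v where "collapsible (g k) U" "v \<notin> verts (g k) - U"
          "Hs (g k) = collapse (g k) U v" "F = induced (g k) U"
          unfolding reducible_to_def by (elim exE conjE)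
        with \<open>F \<in> D\<close> have "\<exists>Uv. collapsible (g k) (fst Uv) \<and> snd Uv \<notin> verts (g k) - fst Uv \<and>
          Hs (g k) = collapse (g k) (fst Uv) (snd Uv) \<and> induced (g k) (fst Uv) \<in> D"
          by (intro exI[of _ "(U, v)"]) simp
        from someI_ex[OF this] show ?thesis unfolding R_def .
      qed
      \<comment> \<open>Where nothing is collapsed an arbitrary vertex is blown up, since every
        colour has to name one.\<close>
      define v where "v k = (if Hs (g k) = g k then (SOME x. x \<in> verts (g k)) else snd (R k))" for k
      have v: "v k \<in> verts (Hs (g k))" if "k < q" for k
      proof (cases "Hs (g k) = g k")
        case True
        have "verts (g k) \<noteq> {}" using ne that by blast
        then show ?thesis using True unfolding v_def by (simp add: some_in_eq)
      next
        case False
        then have "Hs (g k) = collapse (g k) (fst (R k)) (v k)" using R[OF that] unfolding v_def by simp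
        then show ?thesis unfolding collapse_def by simp
      qed
      have "M * (q * M ^ m * ?w) = ?B ^ Suc p * M" by simp
      then have size: "M * (q * M ^ m * ?w) \<le> card X" using X(2) by simp
      have wpos: "?w > 0" using pos by simp
      have Hg: "three_graph (Hs (g k))" "card (verts (Hs (g k))) \<le> m" if "k < q" for k
        using D(3,4) Suc.prems(1) that by simp_all
      have "\<exists>k<q. \<exists>\<phi> W. W \<subseteq> X \<and> ?w \<le> card W \<and> (\<forall>z\<in>W. inj_on (\<phi>(v k := z)) (verts (Hs (g k))) \<and>
          (\<phi>(v k := z)) ` verts (Hs (g k)) \<subseteq> X \<and>
          (\<forall>e\<in>edges (Hs (g k)). c ((\<phi>(v k := z)) ` e) = k))"
        by (rule blow_up_vertex[OF H[OF Suc.prems(1)] _ _ _ X(1,3) size wpos pos]) (fact Hg v)+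
      then obtain k \<phi> W where k: "k < q" and W: "W \<subseteq> X" "?w \<le> card W"
        and emb: "\<forall>z\<in>W. inj_on (\<phi>(v k := z)) (verts (Hs (g k))) \<and>
          (\<phi>(v k := z)) ` verts (Hs (g k)) \<subseteq> X \<and>
          (\<forall>e\<in>edges (Hs (g k)). c ((\<phi>(v k := z)) ` e) = k)"
        by (elim exE conjE)
      show ?thesis
      proof (cases "Hs (g k) = g k")
        case True
        \<comment> \<open>Here the blown-up hypergraph is \<open>g k\<close> itself, so any one of
          its copies will do.\<close>
        have "W \<noteq> {}" using W(2) wpos by auto
        then obtain z where "z \<in> W" by blast
        then have "mono_embeds (g k) X c k"
          using emb True unfolding mono_embeds_def by (intro exI[of _ "\<phi>(v k := z)"]) simp
        then show ?thesis using k by blast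
      next
        case False
        let ?U = "fst (R k)" and ?F = "induced (g k) (fst (R k))"
        have U: "collapsible (g k) ?U" "v k \<notin> verts (g k) - ?U"
          "Hs (g k) = collapse (g k) ?U (v k)" "?F \<in> D"
          using R[OF k False] False unfolding v_def by simp_all
        \<comment> \<open>Only the target of colour \<open>k\<close> changes, so an embedding in any
          other colour is already one of the required kind.\<close>
        let ?g = "g(k := ?F)"
        have g': "\<forall>j<q. ?g j \<in> D" using Suc.prems(1) U(4) by simp
        have less: "card (verts ?F) < card (verts (g k))"
          using U(1) unfolding collapsible_def induced_def by simp
        have "(\<Sum>j<q. card (verts (?g j))) < (\<Sum>j<q. card (verts (g j)))"
          using k less by (intro sum_strict_mono_ex1) auto
        then have "(\<Sum>j<q. card (verts (?g j))) \<le> p" using Suc.prems(2) by linarith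
        then have forc: "forces ?g q ?w" using Suc.IH[OF g'] by blast
        have fW: "finite W" using W(1) X(1) by (rule finite_subset)
        obtain j where j: "j < q" "mono_embeds (?g j) W c j"
          using forcesD[OF forc fW W(2) coloring_mono[OF X(3) W(1)]] by (elim exE conjE)
        show ?thesis
        proof (cases "j = k")
          case True
          then have F: "mono_embeds ?F W c k" using j(2) by simp
          have "three_graph (g k)" using D(1) Suc.prems(1) k by blast
          then have "mono_embeds (g k) X c k"
            using emb unfolding U(3)
            by (intro mono_embeds_collapse[OF _ U(1,2) _ _ _ F]) blast+
          then show ?thesis using k by blast
        next
          case False
          then have "mono_embeds (g j) X c j" using j(2) mono_embeds_mono[OF _ W(1)] by simp
          then show ?thesis using j(1) by blast
        qed
      qed
    qed
  qed
qed

section \<open>Upper bounds for the higher classes\<close>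

lemma U_class_three_graph: "G \<in> U_class i \<Longrightarrow> three_graph G"
proof (induction i arbitrary: G rule: U_class.induct)
  case (3 i)
  from 3(2) have "G \<in> next_class (U_class (Suc i))" by simp
  then show ?case by (cases) (auto intro: 3(1))
qed simp_all

text \<open>A derivation of membership passes through only finitely many hypergraphs. Collecting
  them gives a set closed under passing to the part \<open>F\<close>, on which the numbers of
  vertices are bounded.\<close>

lemma next_class_closure:
  assumes "G \<in> next_class W"
  shows "\<exists>D. finite D \<and> G \<in> D \<and> D \<subseteq> next_class W \<and>
    (\<forall>G\<in>D. G \<in> W \<or> (\<exists>H\<in>W. \<exists>F\<in>D. reducible_to G H F))"
  using assms
proof (induction rule: next_class.induct)
  case (base G)
  then show ?case by (intro exI[of _ "{G}"]) (auto intro: next_class.base)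
next
  case (reduce G H F)
  then obtain D where D: "finite D" "F \<in> D" "D \<subseteq> next_class W"
    "\<forall>G\<in>D. G \<in> W \<or> (\<exists>H\<in>W. \<exists>F\<in>D. reducible_to G H F)" by blast
  have "G \<in> next_class W" using reduce.hyps by (rule next_class.reduce)
  then show ?case
    using D reduce.hyps(2,3) by (intro exI[of _ "insert G D"]) blast
qed

text \<open>Induction needs the asymmetric statement for all assignments from a finite set, as the
  hypergraphs of the colours are replaced one at a time by their parts \<open>F\<close>, while the
  collapsed hypergraphs lie one class lower. At most \<open>q * n\<close> replacements occur, each
  at the cost of a factor polynomial in the bound \<open>M\<close> of the lower class and
  \<open>q\<close>, so the exponent gains one factor \<open>q\<close>.\<close>

lemma forces_U_class:
  assumes "finite D" "D \<subseteq> U_class (Suc i)"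
  shows "\<exists>C. \<forall>q\<ge>2. \<forall>g. (\<forall>k<q. g k \<in> D) \<longrightarrow> forces g q (q ^ (C * q ^ Suc i))"
  using assms
proof (induction i arbitrary: D)
  case 0
  obtain n where n: "\<forall>G\<in>D. card (verts G) \<le> n"
    using finite_nat_set_iff_bounded_le[of "(\<lambda>G. card (verts G)) ` D"] 0(1) by auto
  have "forces g q (q ^ ((2 * n * n + 3 * n + 2) * q ^ Suc 0))" if "q \<ge> 2" "\<forall>k<q. g k \<in> D" for q g
  proof -
    have "g k \<in> U_class (Suc 0)" "card (verts (g k)) \<le> n" if "k < q" for k
      using that \<open>\<forall>k<q. g k \<in> D\<close> 0(2) n by blast+
    then show ?thesis using forces_U1[of q g n] \<open>q \<ge> 2\<close> by simp
  qed
  then show ?case by blast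
next
  case (Suc i)
  let ?W = "U_class (Suc i)"
  have "\<forall>G\<in>D. \<exists>E. finite E \<and> G \<in> E \<and> E \<subseteq> next_class ?W \<and>
    (\<forall>G\<in>E. G \<in> ?W \<or> (\<exists>H\<in>?W. \<exists>F\<in>E. reducible_to G H F))"
  proof
    fix G assume "G \<in> D"
    then have "G \<in> next_class ?W" using Suc.prems(2) by auto
    then show "\<exists>E. finite E \<and> G \<in> E \<and> E \<subseteq> next_class ?W \<and>
      (\<forall>G\<in>E. G \<in> ?W \<or> (\<exists>H\<in>?W. \<exists>F\<in>E. reducible_to G H F))" by (rule next_class_closure)
  qed
  then obtain cl where cl: "\<forall>G\<in>D. finite (cl G) \<and> G \<in> cl G \<and> cl G \<subseteq> next_class ?W \<and>
    (\<forall>G'\<in>cl G. G' \<in> ?W \<or> (\<exists>H\<in>?W. \<exists>F\<in>cl G. reducible_to G' H F))"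
    unfolding bchoice_iff by blast
  define E where "E = (\<Union>G\<in>D. cl G)"
  have E: "finite E" "D \<subseteq> E" "E \<subseteq> U_class (Suc (Suc i))"
    using cl Suc.prems(1) unfolding E_def by auto
  \<comment> \<open>A hypergraph that already lies in the lower class is not collapsed; the choice
    \<open>H = G\<close> encodes this.\<close>
  have "\<forall>G\<in>E. \<exists>H. H \<in> ?W \<and> (H = G \<or> (\<exists>F\<in>E. reducible_to G H F))"
    using cl unfolding E_def by blast
  then obtain Hs where Hs: "\<forall>G\<in>E. Hs G \<in> ?W \<and> (Hs G = G \<or> (\<exists>F\<in>E. reducible_to G (Hs G) F))"
    unfolding bchoice_iff by blast
  have "finite (Hs ` E)" "Hs ` E \<subseteq> ?W" using E(1) Hs by auto
  then obtain C where C: "\<forall>q\<ge>2. \<forall>g. (\<forall>k<q. g k \<in> Hs ` E) \<longrightarrow> forces g q (q ^ (C * q ^ Suc i))"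
    using Suc.IH[of "Hs ` E"] by (elim impE exE meta_impE)
  obtain n where n: "\<forall>G\<in>E. card (verts G) \<le> n"
    using finite_nat_set_iff_bounded_le[of "(\<lambda>G. card (verts G)) ` E"] E(1) by auto
  obtain m where m: "\<forall>G\<in>E. card (verts (Hs G)) \<le> m"
    using finite_nat_set_iff_bounded_le[of "(\<lambda>G. card (verts (Hs G))) ` E"] E(1) by auto
  \<comment> \<open>Each of the \<open>q * n\<close> factors has exponent at most
    \<open>(C * (m + 1) + 1) * P\<close>, and the last factor \<open>M\<close> has exponent
    \<open>C * P\<close>.\<close>
  let ?C = "(C * (m + 1) + 1) * n + C"
  have "forces g q (q ^ (?C * q ^ Suc (Suc i)))" if q: "q \<ge> 2" and g: "\<forall>k<q. g k \<in> D" for q g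
  proof -
    define P where "P = q ^ Suc i"
    define M where "M = q ^ (C * P)"
    have gE: "\<forall>k<q. g k \<in> E" using g E(2) by blast
    have "(\<Sum>k<q. card (verts (g k))) \<le> (\<Sum>k<q. n)"
      using gE n by (intro sum_mono) auto
    then have "(\<Sum>k<q. card (verts (g k))) \<le> q * n" by simp
    moreover have "forces (\<lambda>k. Hs (g k)) q M" if "\<forall>k<q. g k \<in> E" for g
      using C[rule_format, OF q, of "\<lambda>k. Hs (g k)"] that unfolding M_def P_def by blast
    moreover have "M > 0" "q > 0" using q unfolding M_def by simp_all
    moreover have "three_graph G" "three_graph (Hs G)" if "G \<in> E" for G
      using that E(3) Hs U_class_three_graph by blast+
    ultimately have "forces g q ((M * (q * M ^ m)) ^ (q * n) * M)"
      using gE Hs m by (intro forces_collapse[where D = E and Hs = Hs]) blast+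
    moreover have "(M * (q * M ^ m)) ^ (q * n) * M \<le> q ^ (?C * q ^ Suc (Suc i))"
    proof -
      have q1: "q \<ge> 1" "P \<ge> 1" using q unfolding P_def by simp_all
      have "M * (q * M ^ m) = q ^ (C * P * (m + 1) + 1)"
        unfolding M_def by (simp add: power_add power_mult mult_ac)
      then have "(M * (q * M ^ m)) ^ (q * n) * M = q ^ ((C * P * (m + 1) + 1) * (q * n) + C * P)"
        unfolding M_def by (simp only: power_add[symmetric] power_mult[symmetric])
      also have "\<dots> \<le> q ^ (?C * q ^ Suc (Suc i))"
      proof (rule power_increasing[OF _ q1(1)])
        have "C * P * (m + 1) + 1 \<le> (C * (m + 1) + 1) * P" using q1 by (simp add: algebra_simps)
        then have "(C * P * (m + 1) + 1) * (q * n) \<le> (C * (m + 1) + 1) * P * (q * n)"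
          by (rule mult_right_mono) simp
        also have "\<dots> = (C * (m + 1) + 1) * n * (q * P)" by (simp only: mult_ac)
        finally have "(C * P * (m + 1) + 1) * (q * n) \<le> (C * (m + 1) + 1) * n * (q * P)" .
        moreover have "C * P \<le> C * (q * P)" using q1 by simp
        ultimately have "(C * P * (m + 1) + 1) * (q * n) + C * P \<le> ?C * (q * P)"
          unfolding add_mult_distrib[of "(C * (m + 1) + 1) * n"] by linarith
        then show "(C * P * (m + 1) + 1) * (q * n) + C * P \<le> ?C * q ^ Suc (Suc i)"
          unfolding P_def by simp
      qed
      finally show ?thesis .
    qed
    ultimately show ?thesis by (rule forces_mono)
  qed
  then show ?case by blast
qed

section \<open>Lower bounds\<close>

lemma card_triples_le: "card {e. e \<subseteq> {..<N} \<and> card e = 3} \<le> (N::nat) ^ 3"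
proof -
  have "card {e. e \<subseteq> {..<N} \<and> card e = 3} = N choose 3" using n_subsets[of "{..<N}" 3] by simp
  also have "\<dots> \<le> N ^ 3"
    by (cases "3 \<le> N") (simp_all add: binomial_le_pow binomial_eq_0)
  finally show ?thesis .
qed

lemma finite_triples: "finite {e. e \<subseteq> {..<N::nat} \<and> card e = 3}"
  by (rule finite_subset[of _ "Pow {..<N}"]) auto

text \<open>There are enough colours to give all triples different ones, and a copy of
  \<open>G\<close> has two distinct edges.\<close>

lemma rainbow_lower_bound:
  assumes G: "three_graph G" "card (edges G) \<ge> 2" and "forces (\<lambda>_. G) q M" and "N ^ 3 \<le> q"
  shows "N < ramsey_number G q"
proof -
  let ?T = "{e. e \<subseteq> {..<N} \<and> card e = 3}"
  have "card ?T \<le> card {..<q}" using card_triples_le[of N] assms(4) by simp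
  then obtain c where c: "c ` ?T \<subseteq> {..<q}" "inj_on c ?T"
    using card_le_inj[OF finite_triples[of N], of "{..<q}"] by auto
  have "coloring {..<N} q c" using c(1) unfolding coloring_def by auto
  moreover have "\<not> mono_embeds G {..<N} c k" for k
  proof
    assume "mono_embeds G {..<N} c k"
    then obtain f where f: "inj_on f (verts G)" "f ` verts G \<subseteq> {..<N}" "\<forall>e\<in>edges G. c (f ` e) = k"
      unfolding mono_embeds_def by (elim exE conjE)
    obtain e1 e2 where e: "e1 \<in> edges G" "e2 \<in> edges G" "e1 \<noteq> e2"
      using G(2) by (metis card_le_Suc0_iff_eq card.infinite not_less_eq_eq numeral_2_eq_2 zero_le)
    have T: "f ` e \<in> ?T" if "e \<in> edges G" for e
    proof -
      have "e \<subseteq> verts G" "card e = 3" using three_graph_finite_edge[OF G(1) that] by simp_all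
      then have "card (f ` e) = 3" using card_image[of f e] inj_on_subset[OF f(1)] by simp
      moreover have "f ` e \<subseteq> {..<N}" using \<open>e \<subseteq> verts G\<close> f(2) by blast
      ultimately show ?thesis by simp
    qed
    have "c (f ` e1) = c (f ` e2)" using f(3) e by simp
    then have "f ` e1 = f ` e2" using inj_onD[OF c(2)] T e by blast
    then have "e1 = e2"
      using inj_on_image_eq_iff[OF f(1)] three_graph_finite_edge(2)[OF G(1)] e by blast
    then show False using e(3) by simp
  qed
  ultimately show ?thesis by (intro less_ramsey_number[OF G(1) assms(3)])
qed

section \<open>Covering the triples by tripartitions\<close>

definition separates :: "('b \<Rightarrow> nat) \<Rightarrow> 'b set \<Rightarrow> bool" where
  "separates f e \<longleftrightarrow> f ` e = {0, 1, 2}"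

text \<open>Prescribing the values 0, 1 and 2 at the three elements of \<open>e\<close> leaves
  \<open>3 ^ (card V - 3)\<close> maps, which is the fraction 1/27. The other five orders of the
  values are ignored.\<close>

lemma count_separating:
  fixes V e :: "nat set"
  assumes "finite V" "e \<subseteq> V" "card e = 3"
  shows "3 ^ card V \<le> 27 * card {f \<in> V \<rightarrow>\<^sub>E {0, 1, 2::nat}. separates f e}"
proof -
  obtain x y z where e: "e = {x, y, z}" "x \<noteq> y" "x \<noteq> z" "y \<noteq> z"
    using assms(3) by (auto simp: card_3_iff)
  define S where "S v = (if v = x then {0} else if v = y then {1} else if v = z then {2} else {0, 1, 2::nat})" for v
  have "Pi\<^sub>E V S \<subseteq> {f \<in> V \<rightarrow>\<^sub>E {0, 1, 2}. separates f e}"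
  proof
    fix f assume f: "f \<in> Pi\<^sub>E V S"
    have S: "S v \<subseteq> {0, 1, 2}" for v unfolding S_def by auto
    have "f \<in> V \<rightarrow>\<^sub>E {0, 1, 2}"
      using PiE_mem[OF f] S PiE_arb[OF f] by (intro PiE_I) blast+
    moreover have "f x \<in> S x" "f y \<in> S y" "f z \<in> S z" using f assms(2) e(1) by (auto simp: PiE_iff)
    then have "f x = 0" "f y = 1" "f z = 2" using e unfolding S_def by auto
    then have "separates f e" using e(1) unfolding separates_def by simp
    ultimately show "f \<in> {f \<in> V \<rightarrow>\<^sub>E {0, 1, 2}. separates f e}" by blast
  qed
  moreover have "finite (V \<rightarrow>\<^sub>E {0, 1, 2::nat})" using assms(1) by (intro finite_PiE) auto
  ultimately have le: "card (Pi\<^sub>E V S) \<le> card {f \<in> V \<rightarrow>\<^sub>E {0, 1, 2}. separates f e}"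
    by (intro card_mono) auto
  have "card (Pi\<^sub>E V S) = (\<Prod>v\<in>V. card (S v))" using assms(1) by (rule card_PiE)
  also have "\<dots> = (\<Prod>v\<in>V - e. card (S v)) * (\<Prod>v\<in>e. card (S v))"
    using assms by (intro prod.subset_diff)
  also have "(\<Prod>v\<in>V - e. card (S v)) = (\<Prod>v\<in>V - e. 3)"
    using e(1) by (intro prod.cong) (auto simp: S_def)
  also have "(\<Prod>v\<in>e. card (S v)) = (\<Prod>v\<in>e. 1)"
    using e(1) by (intro prod.cong) (auto simp: S_def)
  finally have "card (Pi\<^sub>E V S) = 3 ^ card (V - e)" by simp
  moreover have "card V = card (V - e) + 3"
    using assms card_Diff_subset[of e V] card_mono[of V e] finite_subset[of e V] by simp
  ultimately show ?thesis using le by (simp add: power_add)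
qed

text \<open>Otherwise every map separates fewer than 1/27 of the triples, contradicting the double
  count of pairs of a triple and a map that separates it.\<close>

lemma separate_one:
  fixes T :: "nat set set"
  assumes "finite V" "finite T" "\<And>e. e \<in> T \<Longrightarrow> e \<subseteq> V \<and> card e = 3"
  shows "\<exists>f :: nat \<Rightarrow> nat. card T \<le> 27 * card {e\<in>T. separates f e}"
proof (rule ccontr)
  assume none: "\<not> ?thesis"
  let ?F = "V \<rightarrow>\<^sub>E {0, 1, 2::nat}"
  have fin: "finite ?F" using assms(1) by (intro finite_PiE) auto
  have cF: "card ?F = 3 ^ card V" using assms(1) by (simp add: card_funcsetE numeral_3_eq_3)
  have "card T * 3 ^ card V = (\<Sum>e\<in>T. 3 ^ card V)" by simp
  also have "\<dots> \<le> (\<Sum>e\<in>T. 27 * card {f \<in> ?F. separates f e})"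
    using assms by (intro sum_mono count_separating) auto
  also have "\<dots> = 27 * (\<Sum>e\<in>T. card {f \<in> ?F. separates f e})" by (simp only: sum_distrib_left)
  also have "(\<Sum>e\<in>T. card {f \<in> ?F. separates f e}) = (\<Sum>f\<in>?F. card {e\<in>T. separates f e})"
    using sum_multicount_gen[OF assms(2) fin, of "\<lambda>e f. separates f e" "\<lambda>f. card {e\<in>T. separates f e}"] by blast
  also have "27 * \<dots> = (\<Sum>f\<in>?F. 27 * card {e\<in>T. separates f e})" by (simp only: sum_distrib_left)
  also have "\<dots> < (\<Sum>f\<in>?F. card T)"
  proof (rule sum_strict_mono[OF fin])
    have "card ?F \<noteq> 0" unfolding cF by simp
    then show "?F \<noteq> {}" by (auto simp only: card.empty)
    show "27 * card {e\<in>T. separates f e} < card T" for f :: "nat \<Rightarrow> nat" using none by (meson not_le)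
  qed
  also have "\<dots> = card T * 3 ^ card V" using cF by simp
  finally show False by simp
qed

text \<open>Greedy choice: each further map leaves at most 26/27 of the triples that remain.\<close>

lemma separate_many:
  fixes T :: "nat set set"
  assumes "finite V" "finite T" "\<And>e. e \<in> T \<Longrightarrow> e \<subseteq> V \<and> card e = 3"
  shows "\<exists>F :: nat \<Rightarrow> nat \<Rightarrow> nat. 27 ^ q * card {e\<in>T. \<forall>i<q. \<not> separates (F i) e} \<le> 26 ^ q * card T"
proof (induction q)
  case (Suc q)
  then obtain F where F: "27 ^ q * card {e\<in>T. \<forall>i<q. \<not> separates (F i) e} \<le> 26 ^ q * card T"
    by blast
  let ?R = "{e\<in>T. \<forall>i<q. \<not> separates (F i) e}"
  have finR: "finite ?R" using assms(2) by simp
  obtain f where f: "card ?R \<le> 27 * card {e\<in>?R. separates f e}"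
    using separate_one[OF assms(1) finR] assms(3) by auto
  let ?F = "F(q := f)"
  have R: "{e\<in>T. \<forall>i<Suc q. \<not> separates (?F i) e} = ?R - {e\<in>?R. separates f e}"
    by (auto simp: less_Suc_eq)
  have "card {e\<in>T. \<forall>i<Suc q. \<not> separates (?F i) e} = card ?R - card {e\<in>?R. separates f e}"
    unfolding R using assms(2) by (intro card_Diff_subset) auto
  then have "27 * card {e\<in>T. \<forall>i<Suc q. \<not> separates (?F i) e} \<le> 26 * card ?R"
    using f by linarith
  then have "27 ^ q * (27 * card {e\<in>T. \<forall>i<Suc q. \<not> separates (?F i) e}) \<le> 27 ^ q * (26 * card ?R)"
    by (rule mult_left_mono) simp
  also have "\<dots> = 26 * (27 ^ q * card ?R)" by simp
  also have "\<dots> \<le> 26 * (26 ^ q * card T)" using F by (intro mult_left_mono) simp_all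
  finally have "27 ^ Suc q * card {e\<in>T. \<forall>i<Suc q. \<not> separates (?F i) e} \<le> 26 ^ Suc q * card T"
    by (simp only: power_Suc mult_ac)
  then show ?case by blast
qed simp

lemma tripartite_if_separated:
  assumes G: "three_graph G" and sep: "\<And>e. e \<in> edges G \<Longrightarrow> separates h e"
  shows "tripartite G"
proof -
  have h: "h ` e = {0, 1, 2}" if "e \<in> edges G" for e using sep[OF that] unfolding separates_def .
  have one: "\<exists>v. {u\<in>e. h u = j} = {v}" if e: "e \<in> edges G" and j: "j \<in> {0, 1, 2}" for e j
  proof -
    have "card (h ` e) = card e" using h[OF e] three_graph_finite_edge[OF G e] by simp
    then have inj: "inj_on h e" using three_graph_finite_edge(1)[OF G e] by (intro eq_card_imp_inj_on)
    obtain v where "v \<in> e" "h v = j" using h[OF e] j by (metis imageE)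
    then have "{u\<in>e. h u = j} = {v}" using inj by (auto dest: inj_onD)
    then show ?thesis ..
  qed
  let ?A = "{v\<in>verts G. h v = 0}" and ?B = "{v\<in>verts G. h v = 1}"
  \<comment> \<open>A complement, so that vertices with values other than 0, 1 and 2, which lie in
    no edge, also belong to a part.\<close>
  let ?C = "verts G - ?A - ?B"
  have "card (e \<inter> ?A) = 1 \<and> card (e \<inter> ?B) = 1 \<and> card (e \<inter> ?C) = 1" if e: "e \<in> edges G" for e
  proof -
    have "e \<subseteq> verts G" using three_graph_finite_edge[OF G e] by simp
    moreover have "\<forall>v\<in>e. h v = 0 \<or> h v = 1 \<or> h v = 2" using h[OF e] by blast
    ultimately have "e \<inter> ?A = {u\<in>e. h u = 0}" "e \<inter> ?B = {u\<in>e. h u = 1}" "e \<inter> ?C = {u\<in>e. h u = 2}"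
      by auto
    then show ?thesis using one[OF e, of 0] one[OF e, of 1] one[OF e, of 2] by auto
  qed
  then show ?thesis
    unfolding tripartite_def by (intro exI[of _ ?A] exI[of _ ?B] exI[of _ ?C]) auto
qed

text \<open>The hypothesis on \<open>N\<close> leaves less than one triple uncovered by the
  \<open>q\<close> tripartitions, hence none. Each triple is coloured by a tripartition that
  separates it, and a copy in colour \<open>k\<close> would pull tripartition \<open>k\<close> back
  to \<open>G\<close>.\<close>

lemma nontripartite_lower_bound:
  assumes G: "three_graph G" "\<not> tripartite G" and "forces (\<lambda>_. G) q M" and "26 ^ q * N ^ 3 < (27::nat) ^ q"
  shows "N < ramsey_number G q"
proof -
  let ?T = "{e. e \<subseteq> {..<N} \<and> card e = 3}"
  have "\<exists>F :: nat \<Rightarrow> nat \<Rightarrow> nat. 27 ^ q * card {e\<in>?T. \<forall>i<q. \<not> separates (F i) e} \<le> 26 ^ q * card ?T"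
    by (rule separate_many[OF finite_lessThan[of N] finite_triples]) simp
  then obtain F :: "nat \<Rightarrow> nat \<Rightarrow> nat"
    where F: "27 ^ q * card {e\<in>?T. \<forall>i<q. \<not> separates (F i) e} \<le> 26 ^ q * card ?T" ..
  have "26 ^ q * card ?T \<le> 26 ^ q * N ^ 3" using card_triples_le[of N] by (intro mult_left_mono) simp_all
  then have "27 ^ q * card {e\<in>?T. \<forall>i<q. \<not> separates (F i) e} < 27 ^ q * 1"
    using F assms(4) by linarith
  then have "card {e\<in>?T. \<forall>i<q. \<not> separates (F i) e} < 1" by (simp only: mult_less_cancel1)
  moreover have "finite {e\<in>?T. \<forall>i<q. \<not> separates (F i) e}" using finite_triples[of N] by simp
  ultimately have "{e\<in>?T. \<forall>i<q. \<not> separates (F i) e} = {}" by (simp only: card_0_eq less_one)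
  then have sep: "\<exists>i. i < q \<and> separates (F i) e" if "e \<subseteq> {..<N}" "card e = 3" for e
    using that by blast
  define c where "c e = (SOME i. i < q \<and> separates (F i) e)" for e
  have c: "c e < q \<and> separates (F (c e)) e" if "e \<subseteq> {..<N}" "card e = 3" for e
    unfolding c_def by (rule someI_ex[OF sep[OF that]])
  have "coloring {..<N} q c" unfolding coloring_def using c by blast
  moreover have "\<not> mono_embeds G {..<N} c k" for k
  proof
    assume "mono_embeds G {..<N} c k"
    then obtain f where f: "inj_on f (verts G)" "f ` verts G \<subseteq> {..<N}" "\<forall>e\<in>edges G. c (f ` e) = k"
      unfolding mono_embeds_def by (elim exE conjE)
    have "separates (F k \<circ> f) e" if "e \<in> edges G" for e
    proof -
      have "e \<subseteq> verts G" "card e = 3" using three_graph_finite_edge[OF G(1) that] by simp_all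
      then have "card (f ` e) = 3" using card_image[of f e] inj_on_subset[OF f(1)] by simp
      moreover have "f ` e \<subseteq> {..<N}" using \<open>e \<subseteq> verts G\<close> f(2) by blast
      ultimately have "separates (F (c (f ` e))) (f ` e)" using c by blast
      then show ?thesis using f(3) that unfolding separates_def by (simp only: image_comp)
    qed
    then have "tripartite G" by (rule tripartite_if_separated[OF G(1)])
    then show False using G(2) by simp
  qed
  ultimately show ?thesis by (intro less_ramsey_number[OF G(1) assms(3)])
qed

section \<open>Membership in the union of the classes\<close>

lemma U_class_mono_Suc: "U_class i \<subseteq> U_class (Suc i)"
proof (cases i)
  case 0
  \<comment> \<open>Any part of a tripartition is met exactly once by every edge.\<close>
  have "G \<in> U_class (Suc 0)" if G: "three_graph G" "tripartite G" for G :: "'a hgraph"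
  proof -
    obtain A B C where "A \<union> B \<union> C = verts G" "\<forall>e\<in>edges G. card (e \<inter> A) = 1 \<and> card (e \<inter> B) = 1 \<and> card (e \<inter> C) = 1"
      using G(2) unfolding tripartite_def by (elim exE conjE)
    then have "A \<subseteq> verts G" "\<forall>e\<in>edges G. card (e \<inter> A) = 1" by blast+
    then show ?thesis using G(1) by auto
  qed
  then show ?thesis using 0 by auto
next
  case (Suc j)
  then show ?thesis by (auto intro: next_class.base)
qed

lemma U_class_mono: "i \<le> j \<Longrightarrow> U_class i \<subseteq> U_class j"
  by (rule lift_Suc_mono_le[where f = U_class]) (rule U_class_mono_Suc)

text \<open>Both hypergraphs are lifted to a common level. The \<open>Suc\<close> makes this level
  positive, where the following level is given by \<open>next_class\<close>.\<close>

lemma U_all_reduce: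
  assumes "three_graph G" "reducible_to G H F" "H \<in> U_all" "F \<in> U_all"
  shows "G \<in> U_all"
proof -
  obtain a b where ab: "H \<in> U_class a" "F \<in> U_class b" using assms(3,4) unfolding U_all_def by blast
  let ?m = "Suc (max a b)"
  have "H \<in> U_class ?m" "F \<in> U_class ?m"
    using subsetD[OF U_class_mono[of a ?m] ab(1)] subsetD[OF U_class_mono[of b ?m] ab(2)] by simp_all
  then have "G \<in> next_class (U_class ?m)"
    using assms(1,2) next_class.reduce next_class.base by metis
  then have "G \<in> U_class (Suc ?m)" by simp
  then show ?thesis unfolding U_all_def by blast
qed

lemma U_all_if_met_once:
  assumes "three_graph G" "S \<subseteq> verts G" "\<And>e. e \<in> edges G \<Longrightarrow> card (e \<inter> S) = 1"
  shows "G \<in> U_all"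
proof -
  have "G \<in> U_class (Suc 0)" using assms by auto
  then show ?thesis unfolding U_all_def by blast
qed

lemma no_edges_U_all: "three_graph G \<Longrightarrow> edges G = {} \<Longrightarrow> G \<in> U_all"
  by (rule U_all_if_met_once[of _ "{}"]) simp_all

lemma three_graph_induced: "three_graph G \<Longrightarrow> U \<subseteq> verts G \<Longrightarrow> three_graph (induced G U)"
  unfolding three_graph_def induced_def using finite_subset by auto

lemma three_graph_collapse:
  assumes G: "three_graph G" and v: "v \<notin> verts G - U"
  shows "three_graph (collapse G U v)"
proof -
  have "e \<subseteq> insert v (verts G - U) \<and> card e = 3" if e: "e \<in> edges (collapse G U v)" for e
  proof -
    consider "e \<in> edges G" "e \<inter> U = {}"
      | x y u where "e = {x, y, v}" "x \<in> verts G - U" "y \<in> verts G - U" "u \<in> U" "{x, y, u} \<in> edges G"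
      using e unfolding collapse_def by auto
    then show ?thesis
    proof cases
      case 1
      then show ?thesis using three_graph_finite_edge[OF G 1(1)] by blast
    next
      case 2
      have "card {x, y, u} = 3" using three_graph_finite_edge[OF G 2(5)] by simp
      then have "x \<noteq> y" by (auto simp: card_insert_if split: if_splits)
      moreover have "x \<noteq> v" "y \<noteq> v" using 2 v by blast+
      ultimately show ?thesis using 2 by simp
    qed
  qed
  moreover have "finite (verts G)" using G unfolding three_graph_def by blast
  ultimately show ?thesis unfolding three_graph_def by (simp add: collapse_def)
qed

text \<open>Let \<open>U\<close> consist of the vertices below the top level. An edge whose pair is
  at the top meets \<open>U\<close> only in its third vertex, and every other edge lies inside
  \<open>U\<close>. Hence after collapsing \<open>U\<close> every edge contains the new vertex, and
  the edges inside \<open>U\<close> are treated by induction. The levels are integers so that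
  negation can reverse their order.\<close>

lemma U_all_of_levels:
  fixes g :: "'a \<Rightarrow> int"
  assumes "three_graph G"
    and "\<And>e. e \<in> edges G \<Longrightarrow> \<exists>x y z. e = {x, y, z} \<and> x \<noteq> y \<and> g x = g y \<and> g z < g x"
  shows "G \<in> U_all"
  using assms
proof (induction "card (verts G)" arbitrary: G rule: less_induct)
  case less
  note G = less.prems(1)
  show ?case
  proof (cases "edges G = {}")
    case True
    then show ?thesis using G by (rule no_edges_U_all[rotated])
  next
    case False
    then obtain e0 where e0: "e0 \<in> edges G" by blast
    then have ne: "verts G \<noteq> {}" using three_graph_finite_edge[OF G e0] by auto
    have finV: "finite (verts G)" using G unfolding three_graph_def by blast
    define t where "t = Max (g ` verts G)"
    define U where "U = {v \<in> verts G. g v < t}"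
    have le: "g v \<le> t" if "v \<in> verts G" for v unfolding t_def using that finV by simp
    have "t \<in> g ` verts G" unfolding t_def using finV ne by (intro Max_in) auto
    then have "U \<subset> verts G" unfolding U_def by auto
    then have cardU: "card U < card (verts G)" using finV by (intro psubset_card_mono)
    have sub: "U \<subseteq> verts G" unfolding U_def by blast
    have edge: "(card (e \<inter> U) = 1 \<or> e \<subseteq> U) \<and> e \<inter> U \<noteq> {}" if e: "e \<in> edges G" for e
    proof -
      obtain x y z where xyz: "e = {x, y, z}" "x \<noteq> y" "g x = g y" "g z < g x"
        using less.prems(2)[OF e] by (elim exE conjE)
      have V: "x \<in> verts G" "y \<in> verts G" "z \<in> verts G"
        using three_graph_finite_edge(2)[OF G e] xyz(1) by simp_all
      have zU: "z \<in> U" using V le[of x] xyz(4) unfolding U_def by simp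
      show ?thesis
      proof (cases "g x = t")
        case True
        then have "x \<notin> U" "y \<notin> U" using xyz(3) unfolding U_def by simp_all
        then have "e \<inter> U = {z}" using zU xyz(1) by blast
        then show ?thesis by simp
      next
        case False
        then have "x \<in> U" "y \<in> U" using V le[of x] xyz(3) unfolding U_def by simp_all
        then show ?thesis using zU xyz(1) by simp
      qed
    qed
    show ?thesis
    proof (cases "card U \<le> 1")
      case True
      \<comment> \<open>\<open>U\<close> is too small to be collapsed, but it is also too small to
        contain an edge, so every edge meets it once.\<close>
      have "card (e \<inter> U) = 1" if e: "e \<in> edges G" for e
      proof -
        have "\<not> e \<subseteq> U"
          using card_mono[of U e] finite_subset[OF sub finV] True three_graph_finite_edge(3)[OF G e] by auto
        then show ?thesis using edge[OF e] by blast
      qed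
      then show ?thesis by (rule U_all_if_met_once[OF G sub])
    next
      case False
      then have "U \<noteq> {}" by auto
      then obtain v where v: "v \<in> U" by blast
      have inter: "card (e \<inter> U) \<noteq> 2" if e: "e \<in> edges G" for e
      proof (cases "e \<subseteq> U")
        case True
        then have "e \<inter> U = e" by blast
        then show ?thesis using three_graph_finite_edge(3)[OF G e] by simp
      next
        case False
        then show ?thesis using edge[OF e] by simp
      qed
      have "collapsible G U" unfolding collapsible_def using sub False cardU inter by simp
      then have "reducible_to G (collapse G U v) (induced G U)"
        unfolding reducible_to_def using v by blast
      moreover have "collapse G U v \<in> U_all"
      proof (rule U_all_if_met_once[of _ "{v}"])
        show "three_graph (collapse G U v)" using v by (intro three_graph_collapse[OF G]) simp
        show "{v} \<subseteq> verts (collapse G U v)" unfolding collapse_def by simp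
        fix e assume e: "e \<in> edges (collapse G U v)"
        have "\<not> (e \<in> edges G \<and> e \<inter> U = {})" using edge[of e] by blast
        then have "v \<in> e" using e unfolding collapse_def by auto
        then show "card (e \<inter> {v}) = 1" by simp
      qed
      moreover have "induced G U \<in> U_all"
      proof (rule less.hyps)
        show "card (verts (induced G U)) < card (verts G)" using cardU unfolding induced_def by simp
        show "three_graph (induced G U)" using three_graph_induced[OF G sub] .
        show "\<exists>x y z. e = {x, y, z} \<and> x \<noteq> y \<and> g x = g y \<and> g z < g x"
          if "e \<in> edges (induced G U)" for e
          using that less.prems(2) unfolding induced_def by simp
      qed
      ultimately show ?thesis by (intro U_all_reduce[OF G])
    qed
  qed
qed

section \<open>Lexicographic products of colourings\<close>

lemma inj_on_div_mod:
  assumes "inj_on f V" "\<And>x y. x \<in> V \<Longrightarrow> y \<in> V \<Longrightarrow> f x div N = f y div (N::nat)"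
  shows "inj_on (\<lambda>v. f v mod N) V"
proof (rule inj_onI)
  fix x y assume xy: "x \<in> V" "y \<in> V" "f x mod N = f y mod N"
  then have "f x = f y" using assms(2)[OF xy(1,2)] by (metis div_mult_mod_eq)
  then show "x = y" using inj_onD[OF assms(1)] xy by blast
qed

text \<open>The quotient of a number below \<open>N * N\<close> is its fibre, the remainder its
  position there. If all vertices share a fibre, the positions form a copy in \<open>c\<close>; if
  no two do, the fibres form one. Otherwise the vertices \<open>U\<close> of a fibre with at least
  two of them are collapsible, because an edge with two vertices in \<open>U\<close> cannot have
  three distinct fibres and so lies inside \<open>U\<close>.\<close>

lemma U_all_of_product:
  assumes c: "\<And>G :: 'a hgraph. three_graph G \<Longrightarrow> mono_embeds G {..<N} c k \<Longrightarrow> G \<in> U_all"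
    and G: "three_graph (G :: 'a hgraph)" "inj_on f (verts G)" "f ` verts G \<subseteq> {..<N * N}"
    and "\<And>e. e \<in> edges G \<Longrightarrow>
      card ((\<lambda>v. f v div N) ` e) = 1 \<and> c ((\<lambda>v. f v mod N) ` e) = k \<or>
      card ((\<lambda>v. f v div N) ` e) = 3 \<and> c ((\<lambda>v. f v div N) ` e) = k"
  shows "G \<in> U_all"
  using G assms(5)
proof (induction "card (verts G)" arbitrary: G rule: less_induct)
  case less
  let ?a = "\<lambda>v. f v div N" and ?b = "\<lambda>v. f v mod N"
  note G = less.prems(1)
  have finV: "finite (verts G)" using G unfolding three_graph_def by blast
  have ab: "?a v < N" "?b v < N" if "v \<in> verts G" for v
  proof -
    have "f v < N * N" using that less.prems(3) by blast
    moreover from this have "N > 0" by (cases N) simp_all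
    ultimately show "?a v < N" "?b v < N" by (simp_all add: less_mult_imp_div_less)
  qed
  have const: "G' \<in> U_all" if G': "three_graph G'" "verts G' \<subseteq> verts G" "edges G' \<subseteq> edges G"
    "\<And>x y. x \<in> verts G' \<Longrightarrow> y \<in> verts G' \<Longrightarrow> ?a x = ?a y" for G'
  proof (rule c[OF G'(1)])
    have "inj_on ?b (verts G')"
      using inj_on_subset[OF less.prems(2) G'(2)] G'(4) by (rule inj_on_div_mod)
    moreover have "?b ` verts G' \<subseteq> {..<N}" using ab(2) G'(2) by auto
    moreover have "c (?b ` e) = k" if e: "e \<in> edges G'" for e
    proof -
      have e': "e \<subseteq> verts G'" "card e = 3" using three_graph_finite_edge[OF G'(1) e] by simp_all
      then have "e \<noteq> {}" by auto
      then obtain x where x: "x \<in> e" by blast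
      have "?a y = ?a x" if "y \<in> e" for y using that x e'(1) G'(4) by blast
      then have "?a ` e = {?a x}" using x by blast
      then have "card (?a ` e) = 1" by simp
      then show ?thesis using less.prems(4)[of e] e G'(3) by auto
    qed
    ultimately show "mono_embeds G' {..<N} c k" unfolding mono_embeds_def by blast
  qed
  show ?case
  proof (cases "inj_on ?a (verts G)")
    case True
    have "?a ` verts G \<subseteq> {..<N}" using ab(1) by auto
    moreover have "c (?a ` e) = k" if e: "e \<in> edges G" for e
    proof -
      have e': "e \<subseteq> verts G" "card e = 3" using three_graph_finite_edge[OF G e] by simp_all
      have "card (?a ` e) = 3" using card_image[OF inj_on_subset[OF True e'(1)]] e'(2) by simp
      then show ?thesis using less.prems(4)[OF e] by simp
    qed
    ultimately have "mono_embeds G {..<N} c k" unfolding mono_embeds_def using True by blast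
    then show ?thesis by (rule c[OF G])
  next
    case False
    then obtain x y where xy: "x \<in> verts G" "y \<in> verts G" "?a x = ?a y" "x \<noteq> y"
      unfolding inj_on_def by blast
    define U where "U = {v \<in> verts G. ?a v = ?a x}"
    have sub: "U \<subseteq> verts G" unfolding U_def by blast
    have finU: "finite U" using finite_subset[OF sub finV] .
    have xU: "x \<in> U" "{x, y} \<subseteq> U" using xy unfolding U_def by simp_all
    have "card {x, y} \<le> card U" by (rule card_mono[OF finU xU(2)])
    then have card2: "2 \<le> card U" using xy(4) by simp
    show ?thesis
    proof (cases "U = verts G")
      case True
      have "?a u = ?a w" if "u \<in> verts G" "w \<in> verts G" for u w
      proof -
        have "u \<in> U" "w \<in> U" using that True by simp_all
        then show ?thesis unfolding U_def by simp
      qed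
      then show ?thesis by (rule const[OF G subset_refl subset_refl])
    next
      case False
      then have psub: "U \<subset> verts G" using sub by blast
      then have cardU: "card U < card (verts G)" using finV by (intro psubset_card_mono)
      have inter: "card (e \<inter> U) \<noteq> 2" if e: "e \<in> edges G" for e
      proof
        assume "card (e \<inter> U) = 2"
        then obtain u w where uw: "e \<inter> U = {u, w}" "u \<noteq> w" by (auto simp: card_2_iff)
        have e': "finite e" "e \<subseteq> verts G" "card e = 3" using three_graph_finite_edge[OF G e] by simp_all
        have au: "?a u = ?a x" "?a w = ?a x" "u \<in> e" "w \<in> e" using uw(1) unfolding U_def by blast+
        have "\<not> inj_on ?a e" using inj_onD[of ?a e u w] au uw(2) by auto
        then have "card (?a ` e) \<noteq> 3" using eq_card_imp_inj_on[OF e'(1), of ?a] e'(3) by auto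
        then have "card (?a ` e) = 1" using less.prems(4)[OF e] by blast
        then obtain s where s: "?a ` e = {s}" by (auto simp: card_1_singleton_iff)
        have "s = ?a x" using s au by (metis imageI singletonD)
        then have "e \<subseteq> U" using s e'(2) unfolding U_def by blast
        then have "e = {u, w}" using uw(1) by blast
        then show False using e'(3) uw(2) by simp
      qed
      have "collapsible G U" unfolding collapsible_def using sub card2 cardU inter by simp
      \<comment> \<open>Taking \<open>x\<close> from \<open>U\<close> as the new vertex allows
        \<open>f\<close> to be used unchanged on the collapsed hypergraph, which is smaller.\<close>
      then have "reducible_to G (collapse G U x) (induced G U)"
        unfolding reducible_to_def using xU(1) by blast
      moreover have "induced G U \<in> U_all"
      proof (rule const)
        show "three_graph (induced G U)" using three_graph_induced[OF G sub] .
        show "verts (induced G U) \<subseteq> verts G" "edges (induced G U) \<subseteq> edges G"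
          using sub unfolding induced_def by auto
        show "?a u = ?a w" if "u \<in> verts (induced G U)" "w \<in> verts (induced G U)" for u w
          using that unfolding induced_def U_def by simp
      qed
      moreover have "collapse G U x \<in> U_all"
      proof (rule less.hyps)
        have vH: "verts (collapse G U x) = insert x (verts G - U)" unfolding collapse_def by simp
        have subH: "verts (collapse G U x) \<subseteq> verts G" unfolding vH using xy(1) by blast
        have "y \<in> verts G" "y \<notin> verts (collapse G U x)" unfolding vH using xy xU(2) by auto
        then have "verts (collapse G U x) \<subset> verts G" using subH by blast
        then show "card (verts (collapse G U x)) < card (verts G)" using finV by (intro psubset_card_mono)
        show "three_graph (collapse G U x)" using xU by (intro three_graph_collapse[OF G]) simp
        show "inj_on f (verts (collapse G U x))" using inj_on_subset[OF less.prems(2) subH] .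
        show "f ` verts (collapse G U x) \<subseteq> {..<N * N}" using less.prems(3) subH by blast
        fix e assume "e \<in> edges (collapse G U x)"
        then consider "e \<in> edges G"
          | p r u where "e = {p, r, x}" "p \<in> verts G - U" "u \<in> U" "{p, r, u} \<in> edges G"
          unfolding collapse_def by auto
        then show "card (?a ` e) = 1 \<and> c (?b ` e) = k \<or> card (?a ` e) = 3 \<and> c (?a ` e) = k"
        proof cases
          case 1
          then show ?thesis by (rule less.prems(4))
        next
          case 2
          \<comment> \<open>Replacing \<open>u\<close> by \<open>x\<close> preserves the fibres but
            not the positions. As \<open>p\<close> lies in another fibre, the edge is transversal,
            so its colour depends only on the fibres.\<close>
          have ne: "?a p \<noteq> ?a x" using 2(2) unfolding U_def by simp
          have au: "?a u = ?a x" using 2(3) unfolding U_def by simp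
          then have same: "?a ` e = ?a ` {p, r, u}" unfolding 2(1) by simp
          have "card (?a ` {p, r, u}) \<noteq> 1"
          proof
            assume "card (?a ` {p, r, u}) = 1"
            then obtain s where "?a ` {p, r, u} = {s}" by (auto simp: card_1_singleton_iff)
            then have "?a p = s" "?a u = s" by blast+
            then show False using ne au by simp
          qed
          then show ?thesis using less.prems(4)[OF 2(4)] same by simp
        qed
      qed
      ultimately show ?thesis by (intro U_all_reduce[OF G])
    qed
  qed
qed

lemma two_valued_triple:
  assumes "card e = 3" "card (h ` e) = 2"
  obtains x y z where "e = {x, y, z}" "x \<noteq> y" "h x = h y" "h z \<noteq> h x"
proof -
  have "finite e" using assms(1) by (auto intro: card_ge_0_finite)
  then have "\<not> inj_on h e" using card_image[of h e] assms by auto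
  then obtain x y where xy: "x \<in> e" "y \<in> e" "x \<noteq> y" "h x = h y" unfolding inj_on_def by blast
  have "card (e - {x, y}) = 1" using xy assms(1) \<open>finite e\<close> by (simp add: card_Diff_subset)
  then obtain z where z: "e - {x, y} = {z}" by (auto simp: card_1_singleton_iff)
  then have e: "e = {x, y, z}" using xy by blast
  have "h z \<noteq> h x"
  proof
    assume "h z = h x"
    then have "h ` e = {h x}" unfolding e using xy(4) by simp
    then show False using assms(2) by simp
  qed
  then show thesis using that e xy by blast
qed

text \<open>The colour has to be a function of the set \<open>e\<close>, so the number of its
  vertices at the maximal level encodes whether the pair lies above or below the third
  vertex.\<close>

lemma card_max_level:
  fixes h :: "'b \<Rightarrow> nat"
  assumes "e = {x, y, z}" "x \<noteq> y" "h x = h y" "h z \<noteq> h x"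
  shows "card {w\<in>e. h w = Max (h ` e)} = (if h z < h x then 2 else 1)"
proof -
  have "Max (h ` e) = max (h x) (h z)" using assms by simp
  then have "{w\<in>e. h w = Max (h ` e)} = (if h z < h x then {x, y} else {z})"
    using assms by auto
  then show ?thesis using assms(2) by simp
qed

text \<open>The colouring of the lexicographic product of a colouring with itself: a triple that is neither
  inside a fibre nor transversal to the fibres gets one of two new colours, according to whether the
  fibre with two of its vertices lies above or below the third vertex.\<close>

lemma product_coloring:
  assumes c: "coloring {..<N} q c"
      "\<And>(G :: 'a hgraph) k. three_graph G \<Longrightarrow> mono_embeds G {..<N} c k \<Longrightarrow> G \<in> U_all"
  shows "\<exists>c'. coloring {..<N * N} (q + 2) c' \<and>
    (\<forall>(G :: 'a hgraph) k. three_graph G \<longrightarrow> mono_embeds G {..<N * N} c' k \<longrightarrow> G \<in> U_all)"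
proof -
  define c' where "c' e = (if card ((\<lambda>x. x div N) ` e) = 1 then c ((\<lambda>x. x mod N) ` e)
    else if card ((\<lambda>x. x div N) ` e) = 3 then c ((\<lambda>x. x div N) ` e)
    else if card {x\<in>e. x div N = Max ((\<lambda>x. x div N) ` e)} = 2 then q else q + 1)" for e
  have small: "card ((\<lambda>x. x div N) ` e) = 1 \<Longrightarrow> c ((\<lambda>x. x mod N) ` e) < q"
    "card ((\<lambda>x. x div N) ` e) = 3 \<Longrightarrow> c ((\<lambda>x. x div N) ` e) < q"
    if e: "e \<subseteq> {..<N * N}" "card e = 3" for e
  proof -
    have dm: "x div N < N" "x mod N < N" if "x \<in> e" for x
    proof -
      have "x < N * N" using that e(1) by blast
      moreover from this have "N > 0" by (cases N) simp_all
      ultimately show "x div N < N" "x mod N < N" by (simp_all add: less_mult_imp_div_less)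
    qed
    show "c ((\<lambda>x. x mod N) ` e) < q" if one: "card ((\<lambda>x. x div N) ` e) = 1"
    proof -
      obtain s where s: "(\<lambda>x. x div N) ` e = {s}" using one by (auto simp: card_1_singleton_iff)
      have eqd: "x div N = y div N" if "x \<in> e" "y \<in> e" for x y
      proof -
        have "x div N \<in> {s}" "y div N \<in> {s}" unfolding s[symmetric] using that by simp_all
        then show ?thesis by simp
      qed
      have "inj_on (\<lambda>x. x mod N) e" by (rule inj_on_div_mod[OF inj_on_id2 eqd])
      then have "card ((\<lambda>x. x mod N) ` e) = 3" using e(2) by (simp add: card_image)
      moreover have "(\<lambda>x. x mod N) ` e \<subseteq> {..<N}" using dm(2) by blast
      ultimately show ?thesis using c(1) unfolding coloring_def by simp
    qed
    show "c ((\<lambda>x. x div N) ` e) < q" if "card ((\<lambda>x. x div N) ` e) = 3"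
    proof -
      have "(\<lambda>x. x div N) ` e \<subseteq> {..<N}" using dm(1) by blast
      then show ?thesis using c(1) that unfolding coloring_def by simp
    qed
  qed
  have col: "coloring {..<N * N} (q + 2) c'"
    unfolding coloring_def
  proof (intro allI impI)
    fix e :: "nat set" assume e: "e \<subseteq> {..<N * N}" "card e = 3"
    show "c' e < q + 2" using small[OF e] unfolding c'_def by auto
  qed
  have "G \<in> U_all" if G: "three_graph G" "mono_embeds G {..<N * N} c' k" for G :: "'a hgraph" and k
  proof -
    obtain f where f: "inj_on f (verts G)" "f ` verts G \<subseteq> {..<N * N}" "\<forall>e\<in>edges G. c' (f ` e) = k"
      using G(2) unfolding mono_embeds_def by (elim exE conjE)
    let ?h = "\<lambda>v. f v div N"
    have e3: "f ` e \<subseteq> {..<N * N}" "card (f ` e) = 3" "card e = 3" "inj_on f e" if e: "e \<in> edges G" for e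
    proof -
      have e': "e \<subseteq> verts G" "card e = 3" using three_graph_finite_edge[OF G(1) e] by simp_all
      show inj: "inj_on f e" using inj_on_subset[OF f(1) e'(1)] .
      show "f ` e \<subseteq> {..<N * N}" using e'(1) f(2) by blast
      show "card (f ` e) = 3" "card e = 3" using card_image[OF inj] e'(2) by simp_all
    qed
    have im: "(\<lambda>x. x div N) ` f ` e = ?h ` e" "(\<lambda>x. x mod N) ` f ` e = (\<lambda>v. f v mod N) ` e" for e
      by (simp_all add: image_image)
    \<comment> \<open>Triples inside a fibre and transversal triples have colours below
      \<open>q\<close>, so in a new colour every edge occupies exactly two fibres.\<close>
    have level: "\<exists>x y z. e = {x, y, z} \<and> x \<noteq> y \<and> ?h x = ?h y \<and>
        (k = q \<and> ?h z < ?h x \<or> k = q + 1 \<and> ?h x < ?h z)"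
      if e: "e \<in> edges G" and k: "k = q \<or> k = q + 1" for e
    proof -
      have ck: "c' (f ` e) = k" using f(3) e by blast
      have ne: "card (?h ` e) \<noteq> 1" "card (?h ` e) \<noteq> 3"
        using small[OF e3(1,2)[OF e]] ck k unfolding c'_def im by auto
      have "finite e" using three_graph_finite_edge[OF G(1) e] by simp
      then have "card (?h ` e) \<le> 3" "card (?h ` e) \<noteq> 0"
        using card_image_le[of e ?h] e3(3)[OF e] by auto
      then have two: "card (?h ` e) = 2" using ne by linarith
      obtain x y z where xyz: "e = {x, y, z}" "x \<noteq> y" "?h x = ?h y" "?h z \<noteq> ?h x"
        by (rule two_valued_triple[OF e3(3)[OF e] two])
      have "f x \<noteq> f y" using inj_onD[OF e3(4)[OF e], of x y] xyz by auto
      then have "card {w\<in>f ` e. w div N = Max ((\<lambda>x. x div N) ` f ` e)} = (if ?h z < ?h x then 2 else 1)"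
        using xyz by (intro card_max_level[of _ "f x" "f y" "f z"]) simp_all
      then have c'e: "c' (f ` e) = (if ?h z < ?h x then q else q + 1)"
        using ne unfolding c'_def im by simp
      have "k = q \<and> ?h z < ?h x \<or> k = q + 1 \<and> ?h x < ?h z"
        using c'e ck xyz(4) by (cases "?h z < ?h x") simp_all
      then show ?thesis using xyz(1-3) by blast
    qed
    consider "k = q" | "k = q + 1" | "k \<noteq> q" "k \<noteq> q + 1" by blast
    then show ?thesis
    proof cases
      case 1
      show ?thesis
      proof (rule U_all_of_levels[OF G(1), of "\<lambda>v. int (?h v)"])
        fix e assume "e \<in> edges G"
        from level[OF this] 1 obtain x y z where "e = {x, y, z}" "x \<noteq> y" "?h x = ?h y" "?h z < ?h x"
          by auto
        then show "\<exists>x y z. e = {x, y, z} \<and> x \<noteq> y \<and> int (?h x) = int (?h y) \<and> int (?h z) < int (?h x)"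
          by (intro exI[of _ x] exI[of _ y] exI[of _ z]) simp
      qed
    next
      case 2
      show ?thesis
      \<comment> \<open>In this colour the third vertex lies above the pair; negation puts it
        below.\<close>
      proof (rule U_all_of_levels[OF G(1), of "\<lambda>v. - int (?h v)"])
        fix e assume "e \<in> edges G"
        from level[OF this] 2 obtain x y z where "e = {x, y, z}" "x \<noteq> y" "?h x = ?h y" "?h x < ?h z"
          by auto
        then show "\<exists>x y z. e = {x, y, z} \<and> x \<noteq> y \<and> - int (?h x) = - int (?h y) \<and> - int (?h z) < - int (?h x)"
          by (intro exI[of _ x] exI[of _ y] exI[of _ z]) simp
      qed
    next
      case 3
      show ?thesis
      proof (rule U_all_of_product[OF c(2) G(1) f(1,2)])
        fix e assume "e \<in> edges G"
        then have "c' (f ` e) = k" using f(3) by blast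
        then show "card (?h ` e) = 1 \<and> c ((\<lambda>v. f v mod N) ` e) = k \<or>
            card (?h ` e) = 3 \<and> c (?h ` e) = k"
          using 3 unfolding c'_def im by (auto split: if_splits)
      qed
    qed
  qed
  then show ?thesis using col by blast
qed

lemma iterated_coloring:
  assumes "coloring {..<N} q c"
      "\<And>(G :: 'a hgraph) k. three_graph G \<Longrightarrow> mono_embeds G {..<N} c k \<Longrightarrow> G \<in> U_all"
  shows "\<exists>c'. coloring {..<N ^ 2 ^ t} (q + 2 * t) c' \<and>
    (\<forall>(G :: 'a hgraph) k. three_graph G \<longrightarrow> mono_embeds G {..<N ^ 2 ^ t} c' k \<longrightarrow> G \<in> U_all)"
proof (induction t)
  case 0
  then show ?case using assms by auto
next
  case (Suc t)
  then obtain c' where c': "coloring {..<N ^ 2 ^ t} (q + 2 * t) c'"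
    "\<forall>(G :: 'a hgraph) k. three_graph G \<longrightarrow> mono_embeds G {..<N ^ 2 ^ t} c' k \<longrightarrow> G \<in> U_all" by blast
  have "N ^ 2 ^ t * N ^ 2 ^ t = N ^ 2 ^ Suc t" by (simp add: power_add[symmetric] mult_2)
  moreover have "q + 2 * t + 2 = q + 2 * Suc t" by simp
  ultimately show ?case
    using product_coloring[OF c'(1)] c'(2) by metis
qed

text \<open>The iteration starts with two vertices and no colours if \<open>q\<close> is even, and
  with three vertices and one colour if \<open>q\<close> is odd. A hypergraph on at most three
  vertices has at most one edge, so any vertex of that edge puts it into
  \<open>U_class 1\<close>.\<close>

lemma iterated_lower_bound:
  fixes G :: "'a hgraph"
  assumes G: "three_graph G" "G \<notin> U_all" and "forces (\<lambda>_. G) q M"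
    and N: "N = 2 \<and> q = 2 * t \<or> N = 3 \<and> q = 1 + 2 * t"
  shows "N ^ 2 ^ t < ramsey_number G q"
proof -
  define q0 :: nat where "q0 = (if N = 2 then 0 else 1)"
  have q: "q = q0 + 2 * t" using N unfolding q0_def by auto
  have tiny: "card e \<le> N" if "e \<subseteq> {..<N}" for e using card_mono[of "{..<N}" e] that by simp
  have "coloring {..<N} q0 (\<lambda>_. 0)"
    unfolding coloring_def
  proof (intro allI impI)
    fix e :: "nat set" assume "e \<subseteq> {..<N}" "card e = 3"
    then show "0 < q0" using tiny[of e] unfolding q0_def by auto
  qed
  moreover have "H \<in> U_all" if H: "three_graph H" "mono_embeds H {..<N} (\<lambda>_. 0) k" for H :: "'a hgraph" and k
  proof -
    obtain f where f: "inj_on f (verts H)" "f ` verts H \<subseteq> {..<N}"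
      using H(2) unfolding mono_embeds_def by blast
    then have "card (verts H) \<le> 3" using card_inj_on_le[of f "verts H" "{..<N}"] N by auto
    then have whole: "e = verts H" if "e \<in> edges H" for e
      using three_graph_finite_edge[OF H(1) that] H(1) unfolding three_graph_def
      by (intro card_seteq) auto
    show ?thesis
    proof (cases "edges H = {}")
      case True
      then show ?thesis using H(1) by (rule no_edges_U_all[rotated])
    next
      case False
      then obtain e where e: "e \<in> edges H" by blast
      then have "verts H \<noteq> {}" using whole[OF e] three_graph_finite_edge(3)[OF H(1) e] by auto
      then obtain x where x: "x \<in> verts H" by blast
      show ?thesis
      proof (rule U_all_if_met_once[OF H(1), of "{x}"])
        show "card (e \<inter> {x}) = 1" if "e \<in> edges H" for e using whole[OF that] x by simp
      qed (use x in simp)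
    qed
  qed
  ultimately obtain c' where c': "coloring {..<N ^ 2 ^ t} q c'"
    "\<forall>(G :: 'a hgraph) k. three_graph G \<longrightarrow> mono_embeds G {..<N ^ 2 ^ t} c' k \<longrightarrow> G \<in> U_all"
    using iterated_coloring[of N q0 "\<lambda>_. 0" t] unfolding q by blast
  then show ?thesis using G by (intro less_ramsey_number[OF G(1) assms(3) c'(1)]) blast
qed

section \<open>Asymptotics\<close>

lemma power_eq_two_powr:
  assumes "q > 0"
  shows "real (q ^ m) = 2 powr (real m * ln (real q) / ln 2)"
proof -
  have "2 powr (real m * ln (real q) / ln 2) = exp (real m * ln (real q))" by (simp add: powr_def)
  also have "\<dots> = real q ^ m" using assms by (simp add: exp_of_nat_mult)
  finally show ?thesis by simp
qed

lemma rainbow_rate: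
  assumes "three_graph G" "card (edges G) \<ge> 2" "forces (\<lambda>_. G) q M" "q > 0"
  shows "real q powr (1 / 3) \<le> real (ramsey_number G q)"
proof -
  define x where "x = real q powr (1 / 3)"
  have x3: "x ^ 3 = real q" unfolding x_def using assms(4) by (simp add: powr_realpow[symmetric] powr_powr)
  have x0: "x \<ge> 0" unfolding x_def by simp
  \<comment> \<open>Rounding down loses nothing, because the lower bound \<open>N\<close> on the
    Ramsey number is strict.\<close>
  define N where "N = nat \<lfloor>x\<rfloor>"
  have N: "real N \<le> x" "x \<le> real N + 1" unfolding N_def using x0 by linarith+
  have "real N ^ 3 \<le> x ^ 3" using N(1) by (intro power_mono) simp_all
  then have "real (N ^ 3) \<le> real q" using x3 by simp
  then have "N < ramsey_number G q"
    using rainbow_lower_bound[OF assms(1-3), of N] by (simp only: of_nat_le_iff)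
  then have "real N + 1 \<le> real (ramsey_number G q)" by linarith
  then show ?thesis using N(2) unfolding x_def by linarith
qed

lemma nontripartite_rate:
  assumes "three_graph G" "\<not> tripartite G" "forces (\<lambda>_. G) q M"
  shows "2 powr (log 2 (27 / 26) / 3 * real q) \<le> real (ramsey_number G q)"
proof -
  define x where "x = (27 / 26 :: real) powr (real q / 3)"
  have "x ^ 3 = (27 / 26) powr real q" unfolding x_def by (simp add: powr_realpow[symmetric] powr_powr)
  then have x3: "x ^ 3 = (27 / 26) ^ q" by (simp add: powr_realpow)
  have x0: "x > 0" unfolding x_def by simp
  \<comment> \<open>The largest integer strictly below \<open>x\<close>, since the condition on
    \<open>N\<close> is itself strict.\<close>
  define N where "N = nat (\<lceil>x\<rceil> - 1)"
  have N: "real N < x" "x \<le> real N + 1" unfolding N_def using x0 by linarith+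
  have "real N ^ 3 < x ^ 3" using N(1) by (intro power_strict_mono) simp_all
  then have "real N ^ 3 * 26 ^ q < 27 ^ q" unfolding x3 by (simp add: power_divide field_simps)
  then have "real (26 ^ q * N ^ 3) < real (27 ^ q)" by (simp add: mult.commute)
  then have "N < ramsey_number G q"
    using nontripartite_lower_bound[OF assms, of N] by (simp only: of_nat_less_iff)
  then have "real N + 1 \<le> real (ramsey_number G q)" by linarith
  moreover have "2 powr (log 2 (27 / 26) / 3 * real q) = x"
    unfolding x_def by (simp add: powr_def log_def)
  ultimately show ?thesis using N(2) by linarith
qed

lemma iterated_rate:
  assumes "three_graph G" "G \<notin> U_all" "forces (\<lambda>_. G) q M"
  shows "2 powr (2 powr (real q / 2)) \<le> real (ramsey_number G q)"
proof (cases "even q")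
  case True
  then obtain t where t: "q = 2 * t" by (elim evenE)
  have "2 ^ 2 ^ t < ramsey_number G q" using t by (intro iterated_lower_bound[OF assms]) simp
  then have "real (2 ^ 2 ^ t) \<le> real (ramsey_number G q)" by (simp only: of_nat_le_iff less_imp_le)
  moreover have "2 powr (2 powr (real q / 2)) = real (2 ^ 2 ^ t)"
  proof -
    have e: "2 powr (real q / 2) = real (2 ^ t)" using t by (simp add: powr_realpow)
    show ?thesis unfolding e powr_realpow[OF zero_less_numeral] by simp
  qed
  ultimately show ?thesis by linarith
next
  case False
  then obtain t where t: "q = 1 + 2 * t" by (elim oddE) simp
  have "3 ^ 2 ^ t < ramsey_number G q" using t by (intro iterated_lower_bound[OF assms]) simp
  then have "real (3 ^ 2 ^ t) \<le> real (ramsey_number G q)" by (simp only: of_nat_le_iff less_imp_le)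
  moreover have "2 powr (2 powr (real q / 2)) \<le> real (3 ^ 2 ^ t)"
  proof -
    have q2: "real q / 2 = 1 / 2 + real t" using t by simp
    have e: "2 powr (real q / 2) = sqrt 2 * 2 ^ t"
      unfolding q2 powr_add by (simp add: powr_realpow powr_half_sqrt)
    \<comment> \<open>For odd \<open>q\<close> the target is \<open>2 powr sqrt 2\<close> raised to
      \<open>2 ^ t\<close>, so three initial vertices suffice once \<open>2 powr sqrt 2\<close> is
      at most 3; this follows from 8 being at most 9.\<close>
    have "sqrt 2 \<le> 3 / 2" by (rule real_le_lsqrt) (simp_all add: power2_eq_square)
    then have "(2::real) powr sqrt 2 \<le> 2 powr (3 / 2)" by (intro powr_mono) simp_all
    also have "\<dots> \<le> 3"
    proof (rule power2_le_imp_le)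
      have "((2::real) powr (3 / 2)) ^ 2 = 2 powr 3" by (simp add: powr_realpow[symmetric] powr_powr)
      then show "((2::real) powr (3 / 2)) ^ 2 \<le> 3 ^ 2" by simp
    qed simp
    finally have "((2::real) powr sqrt 2) ^ 2 ^ t \<le> 3 ^ 2 ^ t" by (intro power_mono) simp_all
    moreover have "((2::real) powr sqrt 2) ^ 2 ^ t = 2 powr (sqrt 2 * 2 ^ t)"
      by (simp add: powr_realpow[symmetric] powr_powr)
    ultimately show ?thesis unfolding e by simp
  qed
  ultimately show ?thesis by linarith
qed

lemma tower_bound:
  fixes q n :: nat
  assumes "q \<ge> 2"
  shows "(q + 1) ^ (((q + 1) ^ (q * n) + 1)\<^sup>2) \<le> 2 ^ (q ^ ((4 * n + 2) * q))"
proof -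
  have "q + 1 \<le> 2 * q" using assms by simp
  also have "\<dots> \<le> q ^ 2" using assms by (simp add: power2_eq_square)
  finally have "(q + 1) ^ (q * n) \<le> (q ^ 2) ^ (q * n)" by (rule power_mono) simp
  also have "\<dots> = q ^ (2 * q * n)" by (simp add: power_mult[symmetric] mult.assoc)
  finally have "(q + 1) ^ (q * n) + 1 \<le> q ^ (2 * q * n) + q ^ (2 * q * n)"
    using assms by (intro add_mono) simp_all
  also have "\<dots> = 2 * q ^ (2 * q * n)" by simp
  also have "\<dots> \<le> q * q ^ (2 * q * n)" by (rule mult_right_mono[OF assms]) simp
  finally have "((q + 1) ^ (q * n) + 1)\<^sup>2 \<le> (q * q ^ (2 * q * n))\<^sup>2" by (rule power_mono) simp
  \<comment> \<open>The factor \<open>q\<close> arises when the outer base \<open>q + 1\<close> is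
    replaced by \<open>2 ^ q\<close>.\<close>
  then have "q * ((q + 1) ^ (q * n) + 1)\<^sup>2 \<le> q * (q * q ^ (2 * q * n))\<^sup>2" by simp
  also have "\<dots> = q ^ (3 + 4 * q * n)"
  proof -
    have square: "(q * q ^ m)\<^sup>2 = q ^ (2 + 2 * m)" for m
      by (simp add: power2_eq_square power_add mult_2)
    have exponent: "3 + 4 * q * n = Suc (2 + 2 * (2 * q * n))" by simp
    show ?thesis unfolding square exponent power_Suc ..
  qed
  also have "\<dots> \<le> q ^ ((4 * n + 2) * q)" using assms by (intro power_increasing) (simp_all add: algebra_simps)
  finally have e: "q * ((q + 1) ^ (q * n) + 1)\<^sup>2 \<le> q ^ ((4 * n + 2) * q)" .
  have "q + 1 \<le> 2 ^ q" using less_exp[of q] by (simp only: Suc_eq_plus1[symmetric] Suc_le_eq)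
  then have "(q + 1) ^ (((q + 1) ^ (q * n) + 1)\<^sup>2) \<le> (2 ^ q) ^ (((q + 1) ^ (q * n) + 1)\<^sup>2)"
    by (rule power_mono) simp
  also have "\<dots> = 2 ^ (q * ((q + 1) ^ (q * n) + 1)\<^sup>2)" by (simp only: power_mult)
  also have "\<dots> \<le> 2 ^ (q ^ ((4 * n + 2) * q))" using e by (rule power_increasing) simp
  finally show ?thesis .
qed

lemma U_class_rate:
  assumes G: "three_graph G" "G \<in> U_class (Suc i)"
  shows "\<exists>b>0. \<forall>q\<ge>2. real (ramsey_number G q) \<le> 2 powr (b * (real q ^ Suc i * ln (real q)))"
proof -
  have "\<exists>C. \<forall>q\<ge>2. \<forall>g. (\<forall>k<q. g k \<in> {G}) \<longrightarrow> forces g q (q ^ (C * q ^ Suc i))"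
    using G(2) by (intro forces_U_class) auto
  then obtain C where C: "\<forall>q\<ge>2. \<forall>g. (\<forall>k<q. g k \<in> {G}) \<longrightarrow> forces g q (q ^ (C * q ^ Suc i))" ..
  \<comment> \<open>The constant is increased by 1 to be positive even if \<open>C\<close> is
    0.\<close>
  have "real (ramsey_number G q) \<le> 2 powr (((real C + 1) / ln 2) * (real q ^ Suc i * ln (real q)))"
    if q: "q \<ge> 2" for q
  proof -
    have "forces (\<lambda>_. G) q (q ^ (C * q ^ Suc i))" using C[rule_format, OF q, of "\<lambda>_. G"] by simp
    then have "ramsey_number G q \<le> q ^ (C * q ^ Suc i)" using q by (intro ramsey_number_le[OF G(1)]) simp_all
    then have "real (ramsey_number G q) \<le> real (q ^ (C * q ^ Suc i))" by (simp only: of_nat_le_iff)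
    also have "\<dots> = 2 powr (real (C * q ^ Suc i) * ln (real q) / ln 2)" using q by (intro power_eq_two_powr) simp
    also have "\<dots> \<le> 2 powr (((real C + 1) / ln 2) * (real q ^ Suc i * ln (real q)))"
    proof (rule powr_mono)
      have "0 \<le> real q ^ Suc i * ln (real q) / ln 2" using q by simp
      then have "real C * (real q ^ Suc i * ln (real q) / ln 2) \<le> (real C + 1) * (real q ^ Suc i * ln (real q) / ln 2)"
        by (intro mult_right_mono) simp_all
      then show "real (C * q ^ Suc i) * ln (real q) / ln 2 \<le> (real C + 1) / ln 2 * (real q ^ Suc i * ln (real q))"
        by (simp add: mult.assoc)
    qed simp
    finally show ?thesis .
  qed
  moreover have "(real C + 1) / ln 2 > 0" by simp
  ultimately show ?thesis by blast
qed

theorem theorem1p4: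
  fixes G :: "'a hgraph"
  assumes "three_graph G" and "card (edges G) \<ge> 2"
  shows
    "(G \<in> U_class 0 \<longrightarrow>
       (\<exists>a b :: real. a > 0 \<and> b > 0 \<and>
          (\<forall>\<^sub>F q :: nat in sequentially.
             real q powr a \<le> real (ramsey_number G q) \<and>
             real (ramsey_number G q) \<le> real q powr b))) \<and>
     (G \<in> U_all - U_class 0 \<longrightarrow>
       (\<exists>a :: real. a > 0 \<and>
          (\<forall>\<^sub>F q :: nat in sequentially. 2 powr (a * real q) \<le> real (ramsey_number G q))) \<and>
       (\<exists>b :: real. b > 0 \<and>
          (\<forall>\<^sub>F q :: nat in sequentially. real (ramsey_number G q) \<le> 2 powr (real q powr b))) \<and>
       (\<forall>l :: nat. G \<in> U_class l \<longrightarrow>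
          (\<exists>b :: real. b > 0 \<and>
             (\<forall>\<^sub>F q :: nat in sequentially.
                real (ramsey_number G q) \<le> 2 powr (b * (real q ^ l * ln (real q))))))) \<and>
     (G \<notin> U_all \<longrightarrow>
       (\<forall>\<^sub>F q :: nat in sequentially.
          2 powr (2 powr (real q / 2)) \<le> real (ramsey_number G q)) \<and>
       (\<exists>b :: real. b > 0 \<and>
          (\<forall>\<^sub>F q :: nat in sequentially.
             real (ramsey_number G q) \<le> 2 powr (2 powr (b * (real q * ln (real q)))))))"
proof -
  note G = assms(1)
  define n where "n = card (verts G)"
  have ev: "eventually P sequentially" if "\<And>q. q \<ge> 2 \<Longrightarrow> P q" for P :: "nat \<Rightarrow> bool"
    using that by (auto simp: eventually_sequentially)
  \<comment> \<open>Besides the upper bound in (c), this supplies the finite bound on which all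
    lower bounds rely.\<close>
  have gen: "forces (\<lambda>_. G) q ((q + 1) ^ (((q + 1) ^ (q * n) + 1)\<^sup>2))" if "q \<ge> 2" for q
    using that G by (intro forces_general) (simp_all add: n_def)
  have "\<exists>a b :: real. a > 0 \<and> b > 0 \<and> (\<forall>\<^sub>F q :: nat in sequentially.
      real q powr a \<le> real (ramsey_number G q) \<and> real (ramsey_number G q) \<le> real q powr b)"
    if "G \<in> U_class 0"
  proof -
    have "tripartite G" using that by simp
    then obtain b where b: "\<forall>q\<ge>2. forces (\<lambda>_. G) q (q ^ b)" using forces_tripartite[OF G] by blast
    \<comment> \<open>The summand 1 keeps the upper exponent positive if \<open>b\<close> is
      0.\<close>
    have "real q powr (1 / 3) \<le> real (ramsey_number G q) \<and>
      real (ramsey_number G q) \<le> real q powr (real b + 1)" if q: "q \<ge> 2" for q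
    proof
      show "real q powr (1 / 3) \<le> real (ramsey_number G q)"
        using q by (intro rainbow_rate[OF assms gen[OF q]]) simp
      have "ramsey_number G q \<le> q ^ b" using b q by (intro ramsey_number_le[OF G]) simp_all
      then have "real (ramsey_number G q) \<le> real q ^ b" by (metis of_nat_le_iff of_nat_power)
      also have "\<dots> = real q powr real b" using q by (simp add: powr_realpow)
      also have "\<dots> \<le> real q powr (real b + 1)" using q by (intro powr_mono) simp_all
      finally show "real (ramsey_number G q) \<le> real q powr (real b + 1)" .
    qed
    then show ?thesis by (intro exI[of _ "1 / 3"] exI[of _ "real b + 1"] conjI ev) simp_all
  qed
  moreover have "\<exists>a :: real. a > 0 \<and>
      (\<forall>\<^sub>F q :: nat in sequentially. 2 powr (a * real q) \<le> real (ramsey_number G q))" if "G \<notin> U_class 0"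
  proof -
    have "\<not> tripartite G" using that G by simp
    then have "2 powr (log 2 (27 / 26) / 3 * real q) \<le> real (ramsey_number G q)" if "q \<ge> 2" for q
      using nontripartite_rate[OF G _ gen[OF that]] by simp
    moreover have "log 2 (27 / 26) / 3 > (0::real)" by simp
    ultimately show ?thesis by (intro exI[of _ "log 2 (27 / 26) / 3"] conjI ev)
  qed
  moreover have "\<exists>b :: real. b > 0 \<and>
      (\<forall>\<^sub>F q :: nat in sequentially. real (ramsey_number G q) \<le> 2 powr (real q powr b))"
    if GU: "G \<in> U_all" "G \<notin> U_class 0"
  proof -
    obtain l where l: "G \<in> U_class l" using GU(1) unfolding U_all_def by blast
    then obtain i where i: "l = Suc i" using GU(2) by (cases l) auto
    obtain b where b: "b > 0"
      "\<forall>q\<ge>2. real (ramsey_number G q) \<le> 2 powr (b * (real q ^ Suc i * ln (real q)))"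
      using U_class_rate[OF G l[unfolded i]] by blast
    \<comment> \<open>The exponent is \<open>i + 1\<close> from the power of \<open>q\<close>, plus
      one for the logarithm and one for the constant \<open>b\<close>, which is at most
      \<open>q\<close> eventually.\<close>
    have "real (ramsey_number G q) \<le> 2 powr (real q powr real (i + 3))" if q: "q \<ge> 2" "real q \<ge> b" for q
    proof -
      have "b * (real q ^ Suc i * ln (real q)) \<le> real q * (real q ^ Suc i * real q)"
        using q b(1) ln_le_minus_one[of "real q"] by (intro mult_mono) simp_all
      also have "\<dots> = real q powr real (i + 3)"
        using q by (simp only: powr_realpow) (simp add: power_add power3_eq_cube)
      finally have "2 powr (b * (real q ^ Suc i * ln (real q))) \<le> 2 powr (real q powr real (i + 3))"
        by (intro powr_mono) simp_all
      then show ?thesis using b(2) q(1) by (meson order_trans)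
    qed
    then have "\<forall>\<^sub>F q in sequentially. real (ramsey_number G q) \<le> 2 powr (real q powr real (i + 3))"
      using eventually_ge_at_top[of "max 2 (nat \<lceil>b\<rceil>)"]
      by (auto elim!: eventually_mono simp: nat_le_iff ceiling_le_iff)
    then show ?thesis by (intro exI[of _ "real (i + 3)"] conjI) simp_all
  qed
  moreover have "\<exists>b :: real. b > 0 \<and> (\<forall>\<^sub>F q :: nat in sequentially.
      real (ramsey_number G q) \<le> 2 powr (b * (real q ^ l * ln (real q))))"
    if GU: "G \<in> U_class l" "G \<notin> U_class 0" for l
  proof -
    obtain i where i: "l = Suc i" using GU by (cases l) auto
    obtain b where "b > 0"
      "\<forall>q\<ge>2. real (ramsey_number G q) \<le> 2 powr (b * (real q ^ l * ln (real q)))"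
      using U_class_rate[OF G GU(1)[unfolded i]] unfolding i by blast
    then show ?thesis by (intro exI[of _ b] conjI ev) blast+
  qed
  moreover have "\<forall>\<^sub>F q :: nat in sequentially. 2 powr (2 powr (real q / 2)) \<le> real (ramsey_number G q)"
    if "G \<notin> U_all"
    using iterated_rate[OF G that gen] by (intro ev)
  moreover have "\<exists>b :: real. b > 0 \<and> (\<forall>\<^sub>F q :: nat in sequentially.
      real (ramsey_number G q) \<le> 2 powr (2 powr (b * (real q * ln (real q)))))"
  proof (intro exI conjI ev)
    let ?b = "(4 * real n + 2) / ln 2"
    show "?b > 0" by simp
    fix q :: nat assume q: "q \<ge> 2"
    have "ramsey_number G q \<le> (q + 1) ^ (((q + 1) ^ (q * n) + 1)\<^sup>2)"
      using gen[OF q] by (rule ramsey_number_le[OF G]) simp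
    also have "\<dots> \<le> 2 ^ (q ^ ((4 * n + 2) * q))" using tower_bound[OF q] .
    finally have "real (ramsey_number G q) \<le> real (2 ^ (q ^ ((4 * n + 2) * q)))" by (simp only: of_nat_le_iff)
    also have "\<dots> = 2 powr real (q ^ ((4 * n + 2) * q))" 
      unfolding powr_realpow[OF zero_less_numeral] by simp
    also have "real (q ^ ((4 * n + 2) * q)) = 2 powr (real ((4 * n + 2) * q) * ln (real q) / ln 2)"
      using q by (intro power_eq_two_powr) simp
    also have "real ((4 * n + 2) * q) * ln (real q) / ln 2 = ?b * (real q * ln (real q))"
      by (simp add: algebra_simps)
    finally show "real (ramsey_number G q) \<le> 2 powr (2 powr (?b * (real q * ln (real q))))" .
  qed
  ultimately show ?thesis by blast
qed

end
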